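(* Consider the setting described in the context. The optimization problem $$\begin{aligned}\min_{\theta_\ell\in\mathbb R^{n_\ell},\ V\in\mathscr F(X),\ \psi\in\mathscr F(\mathbb K)}\ &\langle\psi,\mu^{\bar\pi}\rangle\\ \text{s.t. }\ &\psi=\theta_\ell^T\varphi+\alpha\,q^*V-\mathscr P^*V,\\ &\psi(x,a)\ge0\quad\forall(x,a)\in\mathbb K,\\ &\int_{\mathbb K}\psi(x,a)\,dx\,da\ge1,\\ &\|\theta_\ell\|_1\le\beta_\ell,\quad\|\psi\|_{\infty,\mathbb K}\le\beta_\psi,\quad\|V\|_{\infty,X}\le\beta_V\end{aligned}$$ attains at least one optimal solution, and its optimal value is $0$. Moreover, for any optimal solution $(\theta_\ell^\star,V^\star,\psi^\star)$, $\bar\pi$ is an optimal control policy for the problem of minimizing $\mathbb E\big[\sum_{t=1}^\infty\alpha^{t-1}\ell^\star(\boldsymbol x_t,\boldsymbol a_t)\big]$ over all policies with initial distribution $\mu_1$, where $\ell^\star:=(\theta_\ell^\star)^T\varphi$.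
   Context: **Markov control model.** $X=\prod_{i=1}^{n_x}[x_{i,\min},x_{i,\max}]\subset\mathbb R^{n_x}$ and $A=\prod_{i=1}^{n_a}[a_{i,\min},a_{i,\max}]\subset\mathbb R^{n_a}$ are compact boxes (state and action space); every action in $A$ is feasible in every state; $\mathbb K:=X\times A$. $Q(\cdot|x,a)$ is a transition kernel from $\mathbb K$ to $X$, Lipschitz in total variation: there is $L_Q\ge 0$ with $\|Q(\cdot|\eta_1)-Q(\cdot|\eta_2)\|_{TV}\le L_Q\|\eta_1-\eta_2\|_2$ for all $\eta_1,\eta_2\in\mathbb K$, where $\|\mu\|_{TV}=\sup_{\|v\|_\infty\le1}\int v\,d\mu$. The true running cost is $\bar\ell=\bar\theta_\ell^T\varphi$, where $\varphi=[\varphi_1,\dots,\varphi_{n_\ell}]^T$ is a vector of $L_\varphi$-Lipschitz feature functions on $\mathbb K$ and $\bar\theta_\ell\in\mathbb R^{n_\ell}$; $\bar\ell$ is Lipschitz with constant $\|\bar\theta_\ell\|_1L_\varphi$. $\alpha\in(0,1)$; the initial state has distribution $\mu_1$ with $\operatorname{supp}\mu_1=X$. Policies are sequences of (possibly randomized, history-dependent) stochastic kernels. The expert policy $\bar\pi$ minimizes $\mathbb E\big[\sum_{t\ge1}\alpha^{t-1}\bar\ell(\boldsymbol x_t,\boldsymbol a_t)\big]$ over all policies with initial distribution $\mu_1$, and it is deterministic and stationary: $\boldsymbol a_t=\bar\pi(\boldsymbol x_t)$ for a measurable $\bar\pi:X\to A$. $\bar V$ is the optimal value function of this problem. **Notation.**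 $\mathscr F(S)$ is the space of bounded measurable functions on $S$. $(q^*V)(x,a)=\int_X V(\chi)Q(d\chi|x,a)$ and $(\mathscr P^*V)(x,a)=V(x)$. $\langle f,\mu\rangle=\int f\,d\mu$. $\mu_t^{\bar\pi}$ is the law of $(\boldsymbol x_t,\boldsymbol a_t)$ under $\bar\pi$ and $\mu^{\bar\pi}:=\sum_{t=1}^\infty\alpha^{t-1}\mu_t^{\bar\pi}$. **Normalization assumption.** $\int_{\mathbb K}\big[\bar\ell(x,a)-\bar V(x)+\alpha\int_X\bar V(y)Q(dy|x,a)\big]dx\,da\ge1$. **Norm bounds.** The constants $\beta_\ell,\beta_\psi,\beta_V$ can be taken arbitrarily large, and are taken large enough that $\bar\theta_\ell$, $\bar\psi:=\bar\ell+\alpha q^*\bar V-\mathscr P^*\bar V$ and $\bar V$ satisfy $\|\bar\theta_\ell\|_1\le\beta_\ell$, $\|\bar\psi\|_\infty\le\beta_\psi$, $\|\bar V\|_\infty\le\beta_V$. *)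

theory Defs
  imports "HOL-Probability.Probability"
begin

text \<open>
  A function on a set \<open>S\<close> is represented by a total function whose values outside \<open>S\<close> are
  irrelevant; measures and measurability on \<open>S\<close> refer to the trace of the Borel sets on \<open>S\<close>.
  Time is counted from 0, so the discount factor of stage \<open>t\<close> is \<open>\<alpha> ^ t\<close>.
\<close>

abbreviation borel_on :: "'a::topological_space set \<Rightarrow> 'a measure" where
  "borel_on S \<equiv> restrict_space borel S"

definition bounded_measurable :: "'a::topological_space set \<Rightarrow> ('a \<Rightarrow> real) set" where
  "bounded_measurable S = {f \<in> borel_measurable (borel_on S). bounded (f ` S)}"

text \<open>The real supremum is only meaningful for \<open>f\<close> bounded on a nonempty \<open>S\<close>.\<close>

definition sup_norm :: "'a set \<Rightarrow> ('a \<Rightarrow> real) \<Rightarrow> real" where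
  "sup_norm S f = (SUP x\<in>S. \<bar>f x\<bar>)"

definition l1_norm :: "real ^ 'n \<Rightarrow> real" where
  "l1_norm v = (\<Sum>i\<in>UNIV. \<bar>v $ i\<bar>)"

text \<open>
  Total variation norm of the signed measure \<open>M - N\<close>, for probability measures \<open>M\<close>, \<open>N\<close> on the
  same measurable space (with this normalization it ranges over \<open>[0, 2]\<close>).
\<close>

definition tv_dist :: "'a measure \<Rightarrow> 'a measure \<Rightarrow> real" where
  "tv_dist M N =
    (SUP v\<in>{v \<in> borel_measurable M. \<forall>x\<in>space M. \<bar>v x\<bar> \<le> 1}. (\<integral>x. v x \<partial>M) - (\<integral>x. v x \<partial>N))"

definition measure_support :: "'a::topological_space measure \<Rightarrow> 'a set" where
  "measure_support M =
    {x \<in> space M. \<forall>U. open U \<longrightarrow> x \<in> U \<longrightarrow> emeasure M (U \<inter> space M) > 0}"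


subsection \<open>Policies and the controlled process\<close>

text \<open>
  \<open>\<pi> t (h, x)\<close> is the distribution of the action at time \<open>t\<close>, given the current state \<open>x\<close> and
  the past state-action pairs \<open>h 0, \<dots>, h (t - 1)\<close>.
\<close>

type_synonym ('x, 'a) policy = "nat \<Rightarrow> (nat \<Rightarrow> 'x \<times> 'a) \<times> 'x \<Rightarrow> 'a measure"

definition policies ::
  "'x::euclidean_space set \<Rightarrow> 'a::euclidean_space set \<Rightarrow> ('x, 'a) policy set" where
  "policies X A =
    {\<pi>. \<forall>t. \<pi> t \<in> (PiM {0..<t} (\<lambda>_. borel_on (X \<times> A))) \<Otimes>\<^sub>M borel_on X
                  \<rightarrow>\<^sub>M prob_algebra (borel_on A)}"

definition stationary_policy ::
  "'a::euclidean_space set \<Rightarrow> ('x::euclidean_space \<Rightarrow> 'a) \<Rightarrow> ('x, 'a) policy" where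
  "stationary_policy A f = (\<lambda>t (h, x). return (borel_on A) (f x))"

text \<open>Conditional law of the state-action pair at time \<open>t\<close> given the pairs before \<open>t\<close>.\<close>

definition step_kernel ::
  "'x::euclidean_space set \<Rightarrow> 'a::euclidean_space set \<Rightarrow> ('x \<times> 'a \<Rightarrow> 'x measure) \<Rightarrow> 'x measure \<Rightarrow>
    ('x, 'a) policy \<Rightarrow> nat \<Rightarrow> (nat \<Rightarrow> 'x \<times> 'a) \<Rightarrow> ('x \<times> 'a) measure" where
  "step_kernel X A Q \<mu> \<pi> t h =
    (if t = 0 then \<mu> else Q (h (t - 1))) \<bind>
      (\<lambda>x. distr (\<pi> t (h, x)) (borel_on (X \<times> A)) (\<lambda>a. (x, a)))"

text \<open>
  Law of the whole trajectory \<open>\<omega> = ((x\<^sub>0, a\<^sub>0), (x\<^sub>1, a\<^sub>1), \<dots>)\<close> with initial state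
  distribution \<open>\<mu>\<close>, obtained from the Ionescu-Tulcea theorem.
\<close>

definition path_measure ::
  "'x::euclidean_space set \<Rightarrow> 'a::euclidean_space set \<Rightarrow> ('x \<times> 'a \<Rightarrow> 'x measure) \<Rightarrow> 'x measure \<Rightarrow>
    ('x, 'a) policy \<Rightarrow> (nat \<Rightarrow> 'x \<times> 'a) measure" where
  "path_measure X A Q \<mu> \<pi> =
    projective_family.lim UNIV
      (Ionescu_Tulcea.CI (step_kernel X A Q \<mu> \<pi>) (\<lambda>_. borel_on (X \<times> A)))
      (\<lambda>_. borel_on (X \<times> A))"

definition discounted_cost ::
  "'x::euclidean_space set \<Rightarrow> 'a::euclidean_space set \<Rightarrow> ('x \<times> 'a \<Rightarrow> 'x measure) \<Rightarrow> real \<Rightarrow>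
    'x measure \<Rightarrow> ('x \<times> 'a \<Rightarrow> real) \<Rightarrow> ('x, 'a) policy \<Rightarrow> real" where
  "discounted_cost X A Q \<alpha> \<mu> l \<pi> = (\<integral>\<omega>. (\<Sum>t. \<alpha> ^ t * l (\<omega> t)) \<partial>path_measure X A Q \<mu> \<pi>)"

definition optimal_policy ::
  "'x::euclidean_space set \<Rightarrow> 'a::euclidean_space set \<Rightarrow> ('x \<times> 'a \<Rightarrow> 'x measure) \<Rightarrow> real \<Rightarrow>
    'x measure \<Rightarrow> ('x \<times> 'a \<Rightarrow> real) \<Rightarrow> ('x, 'a) policy \<Rightarrow> bool" where
  "optimal_policy X A Q \<alpha> \<mu> l = is_arg_min (discounted_cost X A Q \<alpha> \<mu> l) (\<lambda>\<pi>. \<pi> \<in> policies X A)"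

definition optimal_value ::
  "'x::euclidean_space set \<Rightarrow> 'a::euclidean_space set \<Rightarrow> ('x \<times> 'a \<Rightarrow> 'x measure) \<Rightarrow> real \<Rightarrow>
    ('x \<times> 'a \<Rightarrow> real) \<Rightarrow> 'x \<Rightarrow> real" where
  "optimal_value X A Q \<alpha> l x =
    (INF \<pi>\<in>policies X A. discounted_cost X A Q \<alpha> (return (borel_on X) x) l \<pi>)"

definition stage_law ::
  "'x::euclidean_space set \<Rightarrow> 'a::euclidean_space set \<Rightarrow> ('x \<times> 'a \<Rightarrow> 'x measure) \<Rightarrow> 'x measure \<Rightarrow>
    ('x, 'a) policy \<Rightarrow> nat \<Rightarrow> ('x \<times> 'a) measure" where
  "stage_law X A Q \<mu> \<pi> t = distr (path_measure X A Q \<mu> \<pi>) (borel_on (X \<times> A)) (\<lambda>\<omega>. \<omega> t)"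

definition occupation_measure ::
  "'x::euclidean_space set \<Rightarrow> 'a::euclidean_space set \<Rightarrow> ('x \<times> 'a \<Rightarrow> 'x measure) \<Rightarrow> real \<Rightarrow>
    'x measure \<Rightarrow> ('x, 'a) policy \<Rightarrow> ('x \<times> 'a) measure" where
  "occupation_measure X A Q \<alpha> \<mu> \<pi> =
    measure_of (X \<times> A) (sets (borel_on (X \<times> A)))
      (\<lambda>B. \<Sum>t. ennreal (\<alpha> ^ t) * emeasure (stage_law X A Q \<mu> \<pi> t) B)"


subsection \<open>The inverse optimization problem\<close>

definition q_adj :: "('x \<times> 'a \<Rightarrow> 'x measure) \<Rightarrow> ('x \<Rightarrow> real) \<Rightarrow> 'x \<times> 'a \<Rightarrow> real" where
  "q_adj Q V = (\<lambda>\<eta>. \<integral>y. V y \<partial>Q \<eta>)"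

definition p_adj :: "('x \<Rightarrow> real) \<Rightarrow> 'x \<times> 'a \<Rightarrow> real" where
  "p_adj V = (\<lambda>\<eta>. V (fst \<eta>))"

definition ioc_feasible ::
  "'x::euclidean_space set \<Rightarrow> 'a::euclidean_space set \<Rightarrow> ('x \<times> 'a \<Rightarrow> 'x measure) \<Rightarrow> real \<Rightarrow>
    ('x \<times> 'a \<Rightarrow> real ^ 'l) \<Rightarrow> real \<Rightarrow> real \<Rightarrow> real \<Rightarrow>
    (real ^ 'l) \<times> ('x \<Rightarrow> real) \<times> ('x \<times> 'a \<Rightarrow> real) \<Rightarrow> bool" where
  "ioc_feasible X A Q \<alpha> \<phi> \<beta>\<^sub>l \<beta>\<^sub>\<psi> \<beta>\<^sub>V = (\<lambda>(\<theta>, V, \<psi>).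
      V \<in> bounded_measurable X \<and>
      \<psi> \<in> bounded_measurable (X \<times> A) \<and>
      (\<forall>\<eta>\<in>X \<times> A. \<psi> \<eta> = \<theta> \<bullet> \<phi> \<eta> + \<alpha> * q_adj Q V \<eta> - p_adj V \<eta>) \<and>
      (\<forall>\<eta>\<in>X \<times> A. \<psi> \<eta> \<ge> 0) \<and>
      (LINT \<eta>:X \<times> A|lborel. \<psi> \<eta>) \<ge> 1 \<and>
      l1_norm \<theta> \<le> \<beta>\<^sub>l \<and>
      sup_norm (X \<times> A) \<psi> \<le> \<beta>\<^sub>\<psi> \<and>
      sup_norm X V \<le> \<beta>\<^sub>V)"

definition ioc_objective ::
  "('x \<times> 'a) measure \<Rightarrow> (real ^ 'l) \<times> ('x \<Rightarrow> real) \<times> ('x \<times> 'a \<Rightarrow> real) \<Rightarrow> real" where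
  "ioc_objective \<mu> = (\<lambda>(\<theta>, V, \<psi>). \<integral>\<eta>. \<psi> \<eta> \<partial>\<mu>)"


subsection \<open>The trajectory and occupation measures are well defined\<close>

lemma Pair_measurable_borel_on:
  "(\<lambda>(x, a). (x, a)) \<in> borel_on X \<Otimes>\<^sub>M borel_on A
     \<rightarrow>\<^sub>M borel_on ((X :: 'x::euclidean_space set) \<times> (A :: 'a::euclidean_space set))"
proof (rule measurable_restrict_space2)
  have 1: "fst \<in> borel_on X \<Otimes>\<^sub>M borel_on A \<rightarrow>\<^sub>M (borel :: 'x measure)"
    using measurable_fst measurable_restrict_space2_iff by metis
  have 2: "snd \<in> borel_on X \<Otimes>\<^sub>M borel_on A \<rightarrow>\<^sub>M (borel :: 'a measure)"
    using measurable_snd measurable_restrict_space2_iff by metis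
  show "(\<lambda>(x, a). (x, a)) \<in> borel_on X \<Otimes>\<^sub>M borel_on A \<rightarrow>\<^sub>M (borel :: ('x \<times> 'a) measure)"
    using measurable_Pair[OF 1 2] by (simp add: borel_prod case_prod_unfold)
qed (auto simp: space_pair_measure space_restrict_space)

lemma Ionescu_Tulcea_step_kernel:
  fixes X :: "'x::euclidean_space set" and A :: "'a::euclidean_space set"
  assumes Q: "Q \<in> borel_on (X \<times> A) \<rightarrow>\<^sub>M prob_algebra (borel_on X)"
    and \<mu>: "\<mu> \<in> space (prob_algebra (borel_on X))"
    and \<pi>: "\<pi> \<in> policies X A"
  shows "Ionescu_Tulcea (step_kernel X A Q \<mu> \<pi>) (\<lambda>_. borel_on (X \<times> A))"
proof -
  have *: "step_kernel X A Q \<mu> \<pi> t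
      \<in> PiM {0..<t} (\<lambda>_. borel_on (X \<times> A)) \<rightarrow>\<^sub>M prob_algebra (borel_on (X \<times> A))" for t
  proof -
    let ?H = "PiM {0..<t} (\<lambda>_. borel_on (X \<times> A))"
    have \<pi>t: "\<pi> t \<in> ?H \<Otimes>\<^sub>M borel_on X \<rightarrow>\<^sub>M prob_algebra (borel_on A)"
      using \<pi> by (auto simp: policies_def)
    have state: "(\<lambda>h. if t = 0 then \<mu> else Q (h (t - 1))) \<in> ?H \<rightarrow>\<^sub>M prob_algebra (borel_on X)"
    proof (cases t)
      case (Suc n)
      have "(\<lambda>h. h n) \<in> ?H \<rightarrow>\<^sub>M borel_on (X \<times> A)"
        using Suc by (intro measurable_component_singleton) auto
      from measurable_compose[OF this Q] show ?thesis using Suc by simp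
    qed (use \<mu> in simp)
    have pair: "(\<lambda>(p, a). (snd p, a))
        \<in> (?H \<Otimes>\<^sub>M borel_on X) \<Otimes>\<^sub>M borel_on A \<rightarrow>\<^sub>M borel_on (X \<times> A)"
    proof -
      have "(\<lambda>q. (snd (fst q), snd q))
          \<in> (?H \<Otimes>\<^sub>M borel_on X) \<Otimes>\<^sub>M borel_on A \<rightarrow>\<^sub>M borel_on X \<Otimes>\<^sub>M borel_on A"
        by (intro measurable_Pair measurable_compose[OF measurable_fst measurable_snd] measurable_snd)
      from measurable_compose[OF this Pair_measurable_borel_on] show ?thesis
        by (simp add: case_prod_unfold)
    qed
    have "(\<lambda>p. distr (\<pi> t p) (borel_on (X \<times> A)) (\<lambda>a. (snd p, a)))
        \<in> ?H \<Otimes>\<^sub>M borel_on X \<rightarrow>\<^sub>M prob_algebra (borel_on (X \<times> A))"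
      using pair \<pi>t by (intro measurable_distr_prob_space2[where M = "borel_on A"]) auto
    then have "case_prod (\<lambda>h x. distr (\<pi> t (h, x)) (borel_on (X \<times> A)) (\<lambda>a. (x, a)))
        \<in> ?H \<Otimes>\<^sub>M borel_on X \<rightarrow>\<^sub>M prob_algebra (borel_on (X \<times> A))"
      by (simp add: case_prod_unfold)
    from measurable_bind_prob_space2[OF state this] show ?thesis
      unfolding step_kernel_def .
  qed
  show ?thesis
  proof (rule Ionescu_Tulcea.intro)
    fix i
    show "step_kernel X A Q \<mu> \<pi> i
        \<in> PiM {0..<i} (\<lambda>_. borel_on (X \<times> A)) \<rightarrow>\<^sub>M subprob_algebra (borel_on (X \<times> A))"
      using * by (rule measurable_prob_algebraD)
    fix h assume "h \<in> space (PiM {0..<i} (\<lambda>_. borel_on (X \<times> A)))"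
    from measurable_space[OF * this] show "prob_space (step_kernel X A Q \<mu> \<pi> i h)"
      by (simp add: space_prob_algebra)
  qed
qed

lemma emeasure_occupation_measure:
  assumes B: "B \<in> sets (borel_on (X \<times> A))"
  shows "emeasure (occupation_measure X A Q \<alpha> \<mu> \<pi>) B =
    (\<Sum>t. ennreal (\<alpha> ^ t) * emeasure (stage_law X A Q \<mu> \<pi> t) B)"
proof (rule emeasure_measure_of[OF occupation_measure_def])
  show "sets (borel_on (X \<times> A)) \<subseteq> Pow (X \<times> A)"
    using sets.space_closed[of "borel_on (X \<times> A)"] by (simp add: space_restrict_space)
  show "B \<in> sets (occupation_measure X A Q \<alpha> \<mu> \<pi>)"
    using B sets.sigma_sets_eq[of "borel_on (X \<times> A)"] sets.space_closed[of "borel_on (X \<times> A)"]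
    by (simp add: occupation_measure_def space_restrict_space)
  show "positive (sets (occupation_measure X A Q \<alpha> \<mu> \<pi>))
      (\<lambda>B. \<Sum>t. ennreal (\<alpha> ^ t) * emeasure (stage_law X A Q \<mu> \<pi> t) B)"
    by (simp add: positive_def)
  show "countably_additive (sets (occupation_measure X A Q \<alpha> \<mu> \<pi>))
      (\<lambda>B. \<Sum>t. ennreal (\<alpha> ^ t) * emeasure (stage_law X A Q \<mu> \<pi> t) B)"
  proof (rule countably_additiveI)
    fix F :: "nat \<Rightarrow> _"
    assume F: "range F \<subseteq> sets (occupation_measure X A Q \<alpha> \<mu> \<pi>)" "disjoint_family F"
    have sF: "range F \<subseteq> sets (stage_law X A Q \<mu> \<pi> t)" for t
      using F(1) sets.sigma_sets_eq[of "borel_on (X \<times> A)"] sets.space_closed[of "borel_on (X \<times> A)"]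
      by (simp add: occupation_measure_def stage_law_def space_restrict_space)
    have "(\<Sum>i. \<Sum>t. ennreal (\<alpha> ^ t) * emeasure (stage_law X A Q \<mu> \<pi> t) (F i)) =
        (\<Sum>t. \<Sum>i. ennreal (\<alpha> ^ t) * emeasure (stage_law X A Q \<mu> \<pi> t) (F i))"
      using nn_integral_suminf[of "\<lambda>i t. ennreal (\<alpha> ^ t) * emeasure (stage_law X A Q \<mu> \<pi> t) (F i)" "count_space UNIV"]
      by (simp add: nn_integral_count_space_nat)
    also have "\<dots> = (\<Sum>t. ennreal (\<alpha> ^ t) * emeasure (stage_law X A Q \<mu> \<pi> t) (\<Union>i. F i))"
      by (simp add: suminf_emeasure[OF sF F(2)])
    finally show "(\<Sum>i. \<Sum>t. ennreal (\<alpha> ^ t) * emeasure (stage_law X A Q \<mu> \<pi> t) (F i)) =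
        (\<Sum>t. ennreal (\<alpha> ^ t) * emeasure (stage_law X A Q \<mu> \<pi> t) (\<Union>i. F i))" .
  qed
qed

end

theory Submission
  imports Defs
begin

text \<open>
  The objective of the inverse problem is the suboptimality of the expert, measured by the
  candidate value function. Let \<open>\<psi> = l + \<alpha> q\<^sup>*V - P\<^sup>*V\<close>. Under any policy the expectation of
  \<open>(q\<^sup>*V)(x\<^sub>t, a\<^sub>t)\<close> is that of \<open>V(x\<^sub>t\<^sub>+\<^sub>1)\<close>, so the discounted sum of the expectations of \<open>\<psi>\<close>
  telescopes (\<open>discounted_cost_eq_value_plus_advantage\<close>): it equals the cost of the policy minus
  \<open>\<integral>V d\<mu>\<^sub>1\<close>. Two consequences follow when \<open>\<psi> \<ge> 0\<close>. First, \<open>\<integral>V d\<mu>\<^sub>1\<close> is a lower bound for the cost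
  of every policy. Second, the objective \<open>\<langle>\<psi>, \<mu>\<rangle>\<close>, with \<open>\<mu>\<close> the occupation measure of the expert, is
  the gap between the cost of the expert and this lower bound
  (\<open>integral_occupation_measure\<close>). Hence the objective is nonnegative on the feasible set, and a
  feasible point with objective 0 makes the expert attain the lower bound, that is, makes the
  expert optimal for the cost \<open>l\<close>.

  Everything is thus reduced to exhibiting one feasible point with objective 0, and the natural
  candidate is formed by the true cost and its optimal value function \<open>V'\<close>, for which the
  normalization and the norm bounds are among the hypotheses. It remains to see that
  \<open>V'\<close> is bounded and measurable, that its \<open>\<psi>\<close> is nonnegative, and that the cost of the expert,
  which is optimal for the initial law \<open>\<mu>\<^sub>1\<close>, does not exceed \<open>\<integral>V' d\<mu>\<^sub>1\<close>. The definition of \<open>V'\<close> as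
  a pointwise infimum over history-dependent policies gives none of the three directly. They
  come from the Bellman equation: a transition kernel that is Lipschitz in total variation maps
  bounded measurable functions to continuous ones, so value iteration converges uniformly to a
  continuous solution \<open>V\<close> of the Bellman equation (\<open>bellman_fixed_point\<close>). The telescoping
  identity shows that \<open>V\<close> is a lower bound for the cost; a stationary policy whose action is
  within \<open>\<delta>\<close> of the minimum in the Bellman equation comes within \<open>\<delta> / (1 - \<alpha>)\<close> of that bound.
  Such a policy can be chosen measurable by searching a finite net of the action set
  (\<open>measurable_near_minimizer\<close>). Since the same policy is good from all initial states, \<open>V\<close> is
  the optimal value at every state, and \<open>\<integral>V d\<mu>\<^sub>1\<close> is the optimal cost for the initial law
  (\<open>optimal_value_bellman\<close>).
\<close>

section \<open>Bounded measurable functions and probability measures on a set\<close>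

lemma bounded_measurable_bound:
  assumes "f \<in> bounded_measurable S"
  obtains B where "\<And>x. x \<in> S \<Longrightarrow> \<bar>f x\<bar> \<le> B"
  using assms by (auto simp: bounded_measurable_def bounded_iff)

lemma bounded_measurableI:
  assumes "f \<in> borel_measurable (borel_on S)" and "\<And>x. x \<in> S \<Longrightarrow> \<bar>f x\<bar> \<le> B"
  shows "f \<in> bounded_measurable S"
  using assms by (auto simp: bounded_measurable_def bounded_iff)

lemma prob_algebraD_borel_on:
  assumes "M \<in> space (prob_algebra (borel_on S))"
  shows "prob_space M" "sets M = sets (borel_on S)" "space M = S"
  using assms sets_eq_imp_space_eq[of M "borel_on S"]
  by (auto simp: space_prob_algebra space_restrict_space)

lemma integrable_bounded_measurable:
  assumes f: "f \<in> bounded_measurable S" and M: "M \<in> space (prob_algebra (borel_on S))"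
  shows "integrable M f"
proof -
  note * = prob_algebraD_borel_on[OF M]
  interpret prob_space M by fact
  obtain B where "\<And>x. x \<in> S \<Longrightarrow> \<bar>f x\<bar> \<le> B"
    using bounded_measurable_bound[OF f] by metis
  then show ?thesis
    using f *(3)
    by (intro integrable_const_bound[of f B] AE_I2)
       (auto simp: bounded_measurable_def measurable_cong_sets[OF *(2) refl])
qed

lemma abs_integral_le_bound:
  assumes f: "f \<in> bounded_measurable S" and M: "M \<in> space (prob_algebra (borel_on S))"
    and B: "\<And>x. x \<in> S \<Longrightarrow> \<bar>f x\<bar> \<le> B"
  shows "\<bar>\<integral>x. f x \<partial>M\<bar> \<le> B"
proof -
  note * = prob_algebraD_borel_on[OF M]
  interpret prob_space M by fact
  have f': "integrable M (\<lambda>x. \<bar>f x\<bar>)"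
    using integrable_bounded_measurable[OF f M] by simp
  have "\<bar>\<integral>x. f x \<partial>M\<bar> \<le> (\<integral>x. \<bar>f x\<bar> \<partial>M)"
    by (rule integral_abs_bound)
  also have "\<dots> \<le> B"
    using f' B *(3) by (intro integral_le_const AE_I2) auto
  finally show ?thesis .
qed

lemma bounded_measurable_q_adj:
  assumes Q: "Q \<in> borel_on (X \<times> A) \<rightarrow>\<^sub>M prob_algebra (borel_on X)" and V: "V \<in> bounded_measurable X"
  shows "q_adj Q V \<in> bounded_measurable (X \<times> A)"
proof -
  obtain B where "\<And>x. x \<in> X \<Longrightarrow> \<bar>V x\<bar> \<le> B"
    using bounded_measurable_bound[OF V] by metis
  then have "\<bar>q_adj Q V \<eta>\<bar> \<le> B" if "\<eta> \<in> X \<times> A" for \<eta>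
    unfolding q_adj_def using that
    by (intro abs_integral_le_bound[OF V measurable_space[OF Q]]) (auto simp: space_restrict_space)
  moreover have "q_adj Q V \<in> borel_measurable (borel_on (X \<times> A))"
    using measurable_compose[OF measurable_prob_algebraD[OF Q] integral_measurable_subprob_algebra] V
    by (auto simp: q_adj_def bounded_measurable_def)
  ultimately show ?thesis
    by (rule bounded_measurableI[rotated])
qed

lemma bounded_measurable_advantage:
  assumes l: "l \<in> bounded_measurable S" and q: "q \<in> bounded_measurable S" and p: "p \<in> bounded_measurable S"
  shows "(\<lambda>\<eta>. l \<eta> + \<alpha> * q \<eta> - p \<eta> :: real) \<in> bounded_measurable S"
proof -
  obtain B1 B2 B3 where B: "\<And>x. x \<in> S \<Longrightarrow> \<bar>l x\<bar> \<le> B1" "\<And>x. x \<in> S \<Longrightarrow> \<bar>q x\<bar> \<le> B2" "\<And>x. x \<in> S \<Longrightarrow> \<bar>p x\<bar> \<le> B3"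
    using assms[THEN bounded_measurable_bound] by metis
  have "\<bar>l \<eta> + \<alpha> * q \<eta> - p \<eta>\<bar> \<le> B1 + \<bar>\<alpha>\<bar> * B2 + B3" if "\<eta> \<in> S" for \<eta>
  proof -
    have "\<bar>\<alpha> * q \<eta>\<bar> \<le> \<bar>\<alpha>\<bar> * B2"
      using B(2)[OF that] by (simp add: abs_mult mult_left_mono)
    then show ?thesis
      using B(1)[OF that] B(3)[OF that] by linarith
  qed
  then show ?thesis
    using assms by (intro bounded_measurableI) (auto simp: bounded_measurable_def)
qed

section \<open>The law of the controlled process at a fixed time\<close>

locale controlled_process =
  fixes X :: "'x::euclidean_space set" and A :: "'a::euclidean_space set"
    and Q :: "'x \<times> 'a \<Rightarrow> 'x measure" and \<mu> :: "'x measure" and \<pi> :: "('x, 'a) policy"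
  assumes kernel: "Q \<in> borel_on (X \<times> A) \<rightarrow>\<^sub>M prob_algebra (borel_on X)"
    and initial: "\<mu> \<in> space (prob_algebra (borel_on X))"
    and policy: "\<pi> \<in> policies X A"
begin

abbreviation "K \<equiv> borel_on (X \<times> A)"

sublocale IT: Ionescu_Tulcea "step_kernel X A Q \<mu> \<pi>" "\<lambda>_. K"
  by (rule Ionescu_Tulcea_step_kernel[OF kernel initial policy])

abbreviation "history_law t \<equiv> IT.C 0 t (\<lambda>_. undefined)"

lemma path_measure_eq: "path_measure X A Q \<mu> \<pi> = IT.PF.lim"
  by (simp add: path_measure_def)

text \<open>
  The law of the coordinates indexed by the empty set is a probability measure, and the preimage of
  its only point is the whole path space.
\<close>

lemma prob_space_path: "prob_space (path_measure X A Q \<mu> \<pi>)"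
proof
  have "emeasure IT.PF.lim (IT.PF.emb UNIV {} {\<lambda>_. undefined}) = emeasure (IT.CI {}) {\<lambda>_. undefined}"
    by (rule IT.lim) (auto simp: PiM_empty)
  moreover have "emeasure (IT.CI {}) (space (IT.CI {})) = 1"
    by (intro prob_space.emeasure_space_1 IT.PF.prob_space_P) auto
  moreover have "space (IT.CI {}) = {\<lambda>_. undefined}"
    by (simp add: IT.PF.space_P space_PiM)
  moreover have "IT.PF.emb UNIV {} {\<lambda>_. undefined} = space IT.PF.lim"
    by (auto simp: prod_emb_def IT.PF.space_lim space_PiM)
  ultimately show "emeasure (path_measure X A Q \<mu> \<pi>) (space (path_measure X A Q \<mu> \<pi>)) = 1"
    by (simp add: path_measure_eq)
qed

lemma measurable_coordinate:
  "(\<lambda>\<omega>. \<omega> t) \<in> path_measure X A Q \<mu> \<pi> \<rightarrow>\<^sub>M K"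
  unfolding path_measure_eq measurable_cong_sets[OF IT.PF.sets_lim refl]
  by (rule measurable_component_singleton) simp

text \<open>
  Connects the path measure with the recursive description of the process, on which the one-step
  transitions are visible.
\<close>

lemma distr_history:
  "distr (path_measure X A Q \<mu> \<pi>) (PiM {0..<t} (\<lambda>_. K)) (\<lambda>\<omega>. restrict \<omega> {0..<t}) = history_law t"
proof -
  have "IT.up_to {0..<t} = t"
    unfolding IT.up_to_def by (rule Least_equality) (auto simp: not_less intro: leI)
  then have "IT.CI {0..<t} = history_law t"
    using IT.distr_C[of t t "\<lambda>_. undefined" 0] by (simp add: IT.CI_def)
  with IT.distr_lim[of "{0..<t}"] show ?thesis
    by (simp add: path_measure_eq)
qed

lemma stage_law_eq_bind:
  "stage_law X A Q \<mu> \<pi> t = history_law t \<bind> step_kernel X A Q \<mu> \<pi> t"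
proof -
  let ?H = "\<lambda>n. PiM {0..<n} (\<lambda>_. K)"
  have last: "(\<lambda>h. h t) \<in> ?H (Suc t) \<rightarrow>\<^sub>M K"
    by (rule measurable_component_singleton) simp
  have restr: "(\<lambda>\<omega>. restrict \<omega> {0..<Suc t}) \<in> path_measure X A Q \<mu> \<pi> \<rightarrow>\<^sub>M ?H (Suc t)"
    unfolding path_measure_eq measurable_cong_sets[OF IT.PF.sets_lim refl]
    by (intro measurable_restrict_subset) simp
  have "stage_law X A Q \<mu> \<pi> t = distr (history_law (Suc t)) K (\<lambda>h. h t)"
    unfolding stage_law_def distr_history[symmetric]
    by (simp add: distr_distr[OF last restr] comp_def)
  also have "\<dots> = distr (history_law t \<bind> IT.eP t) K (\<lambda>h. h t)"
    by simp
  also have "\<dots> = history_law t \<bind> (\<lambda>h. distr (IT.eP t h) K (\<lambda>h. h t))"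
  proof (rule distr_bind[OF _ _ last])
    show "IT.eP t \<in> history_law t \<rightarrow>\<^sub>M subprob_algebra (?H (Suc t))"
      using IT.measurable_eP[of t]
      by (simp add: measurable_cong_sets[OF IT.sets_C refl])
    show "space (history_law t) \<noteq> {}"
      by (intro prob_space.not_empty IT.prob_space_C) simp
  qed
  also have "\<dots> = history_law t \<bind> step_kernel X A Q \<mu> \<pi> t"
  proof (rule bind_cong[OF refl])
    fix h assume "h \<in> space (history_law t)"
    then have h: "h \<in> space (?H t)"
      by (simp add: IT.space_C)
    have upd: "fun_upd h t \<in> step_kernel X A Q \<mu> \<pi> t h \<rightarrow>\<^sub>M ?H (Suc t)"
      unfolding measurable_cong_sets[OF IT.sets_P[OF h] refl] using h
      by (intro measurable_fun_upd[where J="{0..<t}"]) auto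
    have "distr (IT.eP t h) K (\<lambda>h. h t) = distr (step_kernel X A Q \<mu> \<pi> t h) K (\<lambda>x. x)"
      by (simp add: IT.eP_def distr_distr[OF last upd] comp_def)
    also have "\<dots> = step_kernel X A Q \<mu> \<pi> t h"
      by (simp add: distr_id2 IT.sets_P[OF h])
    finally show "distr (IT.eP t h) K (\<lambda>h. h t) = step_kernel X A Q \<mu> \<pi> t h" .
  qed
  finally show ?thesis .
qed

lemma sets_history_law: "sets (history_law t) = sets (PiM {0..<t} (\<lambda>_. K))"
  by (simp add: IT.sets_C)

lemma stage_law_in_prob_algebra: "stage_law X A Q \<mu> \<pi> t \<in> space (prob_algebra K)"
  using prob_space.prob_space_distr[OF prob_space_path measurable_coordinate]
  by (simp add: space_prob_algebra stage_law_def)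

abbreviation "state_kernel (t::nat) h \<equiv> (if t = 0 then \<mu> else Q (h (t - 1)))"

lemma measurable_state_kernel:
  "state_kernel t \<in> PiM {0..<t} (\<lambda>_. K) \<rightarrow>\<^sub>M prob_algebra (borel_on X)"
proof (cases t)
  case (Suc n)
  have "(\<lambda>h. h n) \<in> PiM {0..<t} (\<lambda>_. K) \<rightarrow>\<^sub>M K"
    using Suc by (intro measurable_component_singleton) auto
  from measurable_compose[OF this kernel] show ?thesis
    using Suc by simp
qed (use initial in simp)

lemma fst_measurable: "fst \<in> K \<rightarrow>\<^sub>M borel_on X"
proof (rule measurable_restrict_space2)
  show "fst \<in> K \<rightarrow>\<^sub>M (borel :: 'x measure)"
    by (intro measurable_restrict_space1 borel_measurable_continuous_onI) (intro continuous_intros)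
qed (auto simp: space_restrict_space)

lemma Pair_measurable: "x \<in> X \<Longrightarrow> Pair x \<in> borel_on A \<rightarrow>\<^sub>M K"
  using measurable_compose[OF measurable_Pair1' Pair_measurable_borel_on[of X A]]
  by (simp add: space_restrict_space)

lemma measurable_action_kernel:
  assumes h: "h \<in> space (PiM {0..<t} (\<lambda>_. K))"
  shows "(\<lambda>x. distr (\<pi> t (h, x)) K (Pair x)) \<in> borel_on X \<rightarrow>\<^sub>M prob_algebra K"
proof (rule measurable_distr_prob_space2)
  have "\<pi> t \<in> PiM {0..<t} (\<lambda>_. K) \<Otimes>\<^sub>M borel_on X \<rightarrow>\<^sub>M prob_algebra (borel_on A)"
    using policy by (auto simp: policies_def)
  from measurable_compose[OF measurable_Pair1'[OF h] this]
  show "(\<lambda>x. \<pi> t (h, x)) \<in> borel_on X \<rightarrow>\<^sub>M prob_algebra (borel_on A)" .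
qed (rule Pair_measurable_borel_on)

text \<open>
  Drawing the action after the state does not change the law of the state, whatever the policy.
\<close>

lemma distr_step_kernel_fst:
  assumes h: "h \<in> space (PiM {0..<t} (\<lambda>_. K))"
  shows "distr (step_kernel X A Q \<mu> \<pi> t h) (borel_on X) fst = state_kernel t h"
proof -
  have S: "state_kernel t h \<in> space (prob_algebra (borel_on X))"
    using measurable_space[OF measurable_state_kernel h] .
  then have sets: "sets (state_kernel t h) = sets (borel_on X)"
    and ne: "space (state_kernel t h) \<noteq> {}"
    and sp: "space (state_kernel t h) = X"
    using sets_eq_imp_space_eq[of "state_kernel t h" "borel_on X"]
    by (auto simp: space_prob_algebra space_restrict_space dest: prob_space.not_empty)
  have "distr (step_kernel X A Q \<mu> \<pi> t h) (borel_on X) fst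
      = state_kernel t h \<bind> (\<lambda>x. distr (distr (\<pi> t (h, x)) K (Pair x)) (borel_on X) fst)"
    unfolding step_kernel_def
    using measurable_prob_algebraD[OF measurable_action_kernel[OF h]]
    by (intro distr_bind[OF _ ne fst_measurable]) (simp only: measurable_cong_sets[OF sets refl])
  also have "\<dots> = state_kernel t h \<bind> return (borel_on X)"
  proof (rule bind_cong[OF refl])
    fix x assume "x \<in> space (state_kernel t h)"
    then have x: "x \<in> X" by (simp only: sp)
    have "(h, x) \<in> space (PiM {0..<t} (\<lambda>_. K) \<Otimes>\<^sub>M borel_on X)"
      using h x by (simp add: space_pair_measure space_restrict_space)
    moreover have "\<pi> t \<in> PiM {0..<t} (\<lambda>_. K) \<Otimes>\<^sub>M borel_on X \<rightarrow>\<^sub>M prob_algebra (borel_on A)"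
      using policy by (auto simp: policies_def)
    ultimately have "\<pi> t (h, x) \<in> space (prob_algebra (borel_on A))"
      by (rule measurable_space[rotated])
    then have "prob_space (\<pi> t (h, x))" and s: "sets (\<pi> t (h, x)) = sets (borel_on A)"
      by (auto simp: space_prob_algebra)
    then interpret prob_space "\<pi> t (h, x)" by simp
    have "Pair x \<in> \<pi> t (h, x) \<rightarrow>\<^sub>M K"
      using Pair_measurable[OF x] by (simp add: measurable_cong_sets[OF s refl])
    then have "distr (distr (\<pi> t (h, x)) K (Pair x)) (borel_on X) fst
        = distr (\<pi> t (h, x)) (borel_on X) (\<lambda>_. x)"
      by (simp add: distr_distr[OF fst_measurable] comp_def)
    also have "\<dots> = return (borel_on X) x"
      using x by (intro distr_const) (simp add: space_restrict_space)
    finally show "distr (distr (\<pi> t (h, x)) K (Pair x)) (borel_on X) fst = return (borel_on X) x" .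
  qed
  also have "\<dots> = state_kernel t h"
    by (rule bind_return''[OF sets])
  finally show ?thesis .
qed

lemma distr_stage_law_fst:
  "distr (stage_law X A Q \<mu> \<pi> t) (borel_on X) fst = history_law t \<bind> state_kernel t"
proof -
  have "distr (stage_law X A Q \<mu> \<pi> t) (borel_on X) fst
      = history_law t \<bind> (\<lambda>h. distr (step_kernel X A Q \<mu> \<pi> t h) (borel_on X) fst)"
    unfolding stage_law_eq_bind
  proof (rule distr_bind[OF _ _ fst_measurable])
    show "step_kernel X A Q \<mu> \<pi> t \<in> history_law t \<rightarrow>\<^sub>M subprob_algebra K"
      using IT.P[of t] by (simp add: measurable_cong_sets[OF IT.sets_C refl])
    show "space (history_law t) \<noteq> {}"
      by (intro prob_space.not_empty IT.prob_space_C) simp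
  qed
  also have "\<dots> = history_law t \<bind> state_kernel t"
    by (intro bind_cong refl distr_step_kernel_fst) (simp add: IT.space_C)
  finally show ?thesis .
qed

lemma distr_stage_law_0_fst: "distr (stage_law X A Q \<mu> \<pi> 0) (borel_on X) fst = \<mu>"
proof -
  have "prob_space \<mu>" and "prob_space (history_law 0)"
    using initial IT.prob_space_C[of "\<lambda>_. undefined" 0 0] by (auto simp: space_prob_algebra)
  then have "history_law 0 \<bind> (\<lambda>_. \<mu>) = \<mu>"
    by (intro bind_const' prob_space_imp_subprob_space)
  then show ?thesis
    by (simp only: distr_stage_law_fst if_True refl)
qed

text \<open>
  The Markov property at the level of one-dimensional laws. The action may depend on the whole
  history, but the next state depends on it only through the current state-action pair.
\<close>

lemma distr_stage_law_Suc_fst: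
  "distr (stage_law X A Q \<mu> \<pi> (Suc t)) (borel_on X) fst = stage_law X A Q \<mu> \<pi> t \<bind> Q"
proof -
  have last: "(\<lambda>h. h t) \<in> history_law (Suc t) \<rightarrow>\<^sub>M K"
    unfolding measurable_cong_sets[OF IT.sets_C[of "\<lambda>_. undefined" 0, simplified] refl]
    by (rule measurable_component_singleton) simp
  have restr: "(\<lambda>\<omega>. restrict \<omega> {0..<Suc t}) \<in> path_measure X A Q \<mu> \<pi> \<rightarrow>\<^sub>M PiM {0..<Suc t} (\<lambda>_. K)"
    unfolding path_measure_eq measurable_cong_sets[OF IT.PF.sets_lim refl]
    by (intro measurable_restrict_subset) simp
  have "distr (history_law (Suc t)) K (\<lambda>h. h t) = stage_law X A Q \<mu> \<pi> t"
    unfolding stage_law_def distr_history[symmetric]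
    by (subst distr_distr[OF _ restr]) (auto simp: comp_def)
  then show ?thesis
    unfolding distr_stage_law_fst
    using bind_distr[OF last measurable_prob_algebraD[OF kernel]]
      prob_space.not_empty[OF IT.prob_space_C[of "\<lambda>_. undefined" 0 "Suc t"]]
    by simp
qed

abbreviation expectation_at :: "nat \<Rightarrow> ('x \<times> 'a \<Rightarrow> real) \<Rightarrow> real" where
  "expectation_at t g \<equiv> (\<integral>\<eta>. g \<eta> \<partial>stage_law X A Q \<mu> \<pi> t)"

lemma expectation_at_le:
  assumes "g \<in> bounded_measurable (X \<times> A)" "\<And>\<eta>. \<eta> \<in> X \<times> A \<Longrightarrow> \<bar>g \<eta>\<bar> \<le> B"
  shows "\<bar>expectation_at t g\<bar> \<le> B"
  by (rule abs_integral_le_bound[OF assms(1) stage_law_in_prob_algebra assms(2)])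

lemma bounded_measurable_p_adj:
  assumes V: "V \<in> bounded_measurable X"
  shows "p_adj V \<in> bounded_measurable (X \<times> A)"
proof -
  obtain B where "\<And>x. x \<in> X \<Longrightarrow> \<bar>V x\<bar> \<le> B"
    using bounded_measurable_bound[OF V] by metis
  moreover have "p_adj V \<in> borel_measurable K"
    using measurable_compose[OF fst_measurable, of V borel] V by (simp add: p_adj_def bounded_measurable_def)
  ultimately show ?thesis
    by (intro bounded_measurableI[where B=B]) (auto simp: p_adj_def)
qed

lemma expectation_at_p_adj:
  assumes V: "V \<in> bounded_measurable X"
  shows "expectation_at t (p_adj V) = (\<integral>x. V x \<partial>distr (stage_law X A Q \<mu> \<pi> t) (borel_on X) fst)"
proof -
  have "fst \<in> stage_law X A Q \<mu> \<pi> t \<rightarrow>\<^sub>M borel_on X"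
    using fst_measurable by (simp add: stage_law_def)
  with V show ?thesis
    by (simp add: integral_distr p_adj_def bounded_measurable_def)
qed

lemma expectation_at_0:
  assumes "V \<in> bounded_measurable X"
  shows "expectation_at 0 (p_adj V) = (\<integral>x. V x \<partial>\<mu>)"
  by (simp add: expectation_at_p_adj[OF assms] distr_stage_law_0_fst)

lemma expectation_at_Suc:
  assumes V: "V \<in> bounded_measurable X"
  shows "expectation_at (Suc t) (p_adj V) = expectation_at t (q_adj Q V)"
proof -
  obtain B where B: "\<And>x. x \<in> X \<Longrightarrow> \<bar>V x\<bar> \<le> B"
    using bounded_measurable_bound[OF V] by metis
  note P = prob_algebraD_borel_on[OF stage_law_in_prob_algebra[of t]]
  interpret prob_space "stage_law X A Q \<mu> \<pi> t" by (rule P)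
  have Qm: "Q \<in> stage_law X A Q \<mu> \<pi> t \<rightarrow>\<^sub>M subprob_algebra (borel_on X)"
    using measurable_prob_algebraD[OF kernel] by (simp add: measurable_cong_sets[OF P(2) refl])
  have "(\<integral>x. V x \<partial>(stage_law X A Q \<mu> \<pi> t \<bind> Q)) = expectation_at t (\<lambda>\<eta>. \<integral>x. V x \<partial>Q \<eta>)"
  proof (rule integral_bind[OF _ _ Qm])
    show "AE \<eta> in stage_law X A Q \<mu> \<pi> t. emeasure (Q \<eta>) (space (Q \<eta>)) \<le> ennreal 1"
    proof (rule AE_I2)
      fix \<eta> assume "\<eta> \<in> space (stage_law X A Q \<mu> \<pi> t)"
      then have "subprob_space (Q \<eta>)"
        by (rule subprob_space_kernel[OF Qm])
      then show "emeasure (Q \<eta>) (space (Q \<eta>)) \<le> ennreal 1"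
        by (simp add: subprob_space.emeasure_space_le_1)
    qed
    show "V \<in> borel_measurable (borel_on X)"
      using V by (simp add: bounded_measurable_def)
    show "finite_measure (stage_law X A Q \<mu> \<pi> t)" by (rule finite_measure_axioms)
    show "\<bar>V x\<bar> \<le> B" if "x \<in> space (borel_on X)" for x
      using B that by (simp add: space_restrict_space)
  qed
  then show ?thesis
    by (simp add: expectation_at_p_adj[OF V] distr_stage_law_Suc_fst q_adj_def)
qed

section \<open>Discounted cost, value functions and the occupation measure\<close>

lemma summable_expectations:
  assumes g: "g \<in> bounded_measurable (X \<times> A)" and \<alpha>: "0 < \<alpha>" "\<alpha> < 1"
  shows "summable (\<lambda>t. \<alpha> ^ t * expectation_at t g)"
proof -
  obtain B where B: "\<And>\<eta>. \<eta> \<in> X \<times> A \<Longrightarrow> \<bar>g \<eta>\<bar> \<le> B"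
    using bounded_measurable_bound[OF g] by metis
  show ?thesis
  proof (rule summable_comparison_test')
    show "summable (\<lambda>t. \<alpha> ^ t * B)"
      using \<alpha> by (intro summable_mult2 summable_geometric) simp
    show "norm (\<alpha> ^ t * expectation_at t g) \<le> \<alpha> ^ t * B" if "t \<ge> 0" for t
      using \<alpha> expectation_at_le[OF g B, of t] by (simp add: abs_mult)
  qed
qed

lemma discounted_cost_eq_suminf:
  assumes l: "l \<in> bounded_measurable (X \<times> A)" and \<alpha>: "0 < \<alpha>" "\<alpha> < 1"
  shows "discounted_cost X A Q \<alpha> \<mu> l \<pi> = (\<Sum>t. \<alpha> ^ t * expectation_at t l)"
proof -
  obtain B where B: "\<And>\<eta>. \<eta> \<in> X \<times> A \<Longrightarrow> \<bar>l \<eta>\<bar> \<le> B"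
    using bounded_measurable_bound[OF l] by metis
  let ?P = "path_measure X A Q \<mu> \<pi>"
  interpret P: prob_space ?P by (rule prob_space_path)
  have lm: "l \<in> borel_measurable K"
    using l by (simp add: bounded_measurable_def)
  have [measurable]: "(\<lambda>\<omega>. l (\<omega> t)) \<in> borel_measurable ?P" for t
    using measurable_compose[OF measurable_coordinate lm] .
  have lB: "\<bar>l (\<omega> t)\<bar> \<le> B" if "\<omega> \<in> space ?P" for \<omega> t
    using B[of "\<omega> t"] measurable_space[OF measurable_coordinate that] by (auto simp: space_restrict_space)
  have int: "integrable ?P (\<lambda>\<omega>. l (\<omega> t))" for t
    using lB by (intro P.integrable_const_bound[of _ B] AE_I2) auto
  have E: "(\<integral>\<omega>. l (\<omega> t) \<partial>?P) = expectation_at t l" for t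
    by (simp add: stage_law_def integral_distr[OF measurable_coordinate lm])
  have geo: "summable (\<lambda>t. \<alpha> ^ t * B)"
    using \<alpha> by (intro summable_mult2 summable_geometric) simp
  have le: "norm (\<alpha> ^ t * l (\<omega> t)) \<le> \<alpha> ^ t * B" if "\<omega> \<in> space ?P" for \<omega> t
    using lB[OF that] \<alpha> by (simp add: abs_mult)
  have "(\<integral>\<omega>. (\<Sum>t. \<alpha> ^ t * l (\<omega> t)) \<partial>?P) = (\<Sum>t. \<integral>\<omega>. \<alpha> ^ t * l (\<omega> t) \<partial>?P)"
  proof (rule integral_suminf)
    show "integrable ?P (\<lambda>\<omega>. \<alpha> ^ t * l (\<omega> t))" for t
      using int by simp
    show "AE \<omega> in ?P. summable (\<lambda>t. norm (\<alpha> ^ t * l (\<omega> t)))"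
      using le by (intro AE_I2 summable_comparison_test'[OF geo]) simp
    show "summable (\<lambda>t. \<integral>\<omega>. norm (\<alpha> ^ t * l (\<omega> t)) \<partial>?P)"
    proof (rule summable_comparison_test'[OF geo])
      fix t :: nat
      have "(\<integral>\<omega>. norm (\<alpha> ^ t * l (\<omega> t)) \<partial>?P) \<le> \<alpha> ^ t * B"
        using int le by (intro P.integral_le_const AE_I2) auto
      then show "norm (\<integral>\<omega>. norm (\<alpha> ^ t * l (\<omega> t)) \<partial>?P) \<le> \<alpha> ^ t * B"
        by (simp add: integral_nonneg_AE)
    qed
  qed
  then show ?thesis
    by (simp add: discounted_cost_def E)
qed

text \<open>
  With \<open>s\<^sub>t\<close> the expectation of \<open>V\<close> at the state of time \<open>t\<close>, the expectation of \<open>\<psi>\<close> at time \<open>t\<close>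
  exceeds that of \<open>l\<close> by \<open>\<alpha> s\<^sub>t\<^sub>+\<^sub>1 - s\<^sub>t\<close>. Discounted by \<open>\<alpha> ^ t\<close> these differences telescope to
  \<open>- s\<^sub>0\<close>. The identity is an equality for every \<open>V\<close>; both the bounds on the optimal cost and
  the meaning of the inverse problem are read off from it.
\<close>

lemma discounted_cost_eq_value_plus_advantage:
  assumes l: "l \<in> bounded_measurable (X \<times> A)" and V: "V \<in> bounded_measurable X"
    and \<psi>: "\<And>\<eta>. \<eta> \<in> X \<times> A \<Longrightarrow> \<psi> \<eta> = l \<eta> + \<alpha> * q_adj Q V \<eta> - p_adj V \<eta>"
    and \<alpha>: "0 < \<alpha>" "\<alpha> < 1"
  shows "discounted_cost X A Q \<alpha> \<mu> l \<pi> = (\<integral>x. V x \<partial>\<mu>) + (\<Sum>t. \<alpha> ^ t * expectation_at t \<psi>)"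
proof -
  let ?s = "\<lambda>t. expectation_at t (p_adj V)"
  note qV = bounded_measurable_q_adj[OF kernel V] and pV = bounded_measurable_p_adj[OF V]
  note int = integrable_bounded_measurable[OF _ stage_law_in_prob_algebra]
  have sp: "space (stage_law X A Q \<mu> \<pi> t) = X \<times> A" for t
    by (rule prob_algebraD_borel_on[OF stage_law_in_prob_algebra])
  have "expectation_at t \<psi> = expectation_at t (\<lambda>\<eta>. l \<eta> + \<alpha> * q_adj Q V \<eta> - p_adj V \<eta>)" for t
    by (intro Bochner_Integration.integral_cong refl \<psi>) (simp add: sp)
  also have "\<dots> t = expectation_at t l + \<alpha> * ?s (Suc t) - ?s t" for t
    using int[OF l, of t] int[OF qV, of t] int[OF pV, of t] expectation_at_Suc[OF V, of t] by simp
  finally have E: "expectation_at t \<psi> = expectation_at t l + \<alpha> * ?s (Suc t) - ?s t" for t .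
  have sum_s: "summable (\<lambda>t. \<alpha> ^ t * ?s t)"
    by (rule summable_expectations[OF pV \<alpha>])
  have sum_l: "summable (\<lambda>t. \<alpha> ^ t * expectation_at t l)"
    by (rule summable_expectations[OF l \<alpha>])
  have "(\<Sum>t. \<alpha> ^ t * expectation_at t \<psi>)
      = (\<Sum>t. \<alpha> ^ t * expectation_at t l + (\<alpha> ^ Suc t * ?s (Suc t) - \<alpha> ^ t * ?s t))"
    by (simp add: E algebra_simps)
  also have "\<dots> = (\<Sum>t. \<alpha> ^ t * expectation_at t l) + (\<Sum>t. \<alpha> ^ Suc t * ?s (Suc t) - \<alpha> ^ t * ?s t)"
    using sum_s sum_l summable_Suc_iff[of "\<lambda>t. \<alpha> ^ t * ?s t"]
    by (intro suminf_add[symmetric] summable_diff) auto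
  also have "(\<Sum>t. \<alpha> ^ Suc t * ?s (Suc t) - \<alpha> ^ t * ?s t) = 0 - \<alpha> ^ 0 * ?s 0"
    by (rule sums_unique[symmetric], rule telescope_sums, rule summable_LIMSEQ_zero[OF sum_s])
  finally show ?thesis
    by (simp add: discounted_cost_eq_suminf[OF l \<alpha>] expectation_at_0[OF V])
qed

text \<open>
  Weak duality: a subsolution of the Bellman equation bounds the cost of every policy from below.
\<close>

lemma integral_le_discounted_cost:
  assumes l: "l \<in> bounded_measurable (X \<times> A)" and V: "V \<in> bounded_measurable X"
    and nonneg: "\<And>\<eta>. \<eta> \<in> X \<times> A \<Longrightarrow> 0 \<le> l \<eta> + \<alpha> * q_adj Q V \<eta> - p_adj V \<eta>"
    and \<alpha>: "0 < \<alpha>" "\<alpha> < 1"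
  shows "(\<integral>x. V x \<partial>\<mu>) \<le> discounted_cost X A Q \<alpha> \<mu> l \<pi>"
proof -
  define \<psi> where "\<psi> \<eta> = l \<eta> + \<alpha> * q_adj Q V \<eta> - p_adj V \<eta>" for \<eta>
  have \<psi>m: "\<psi> \<in> bounded_measurable (X \<times> A)"
    unfolding \<psi>_def
    by (rule bounded_measurable_advantage[OF l bounded_measurable_q_adj[OF kernel V] bounded_measurable_p_adj[OF V]])
  have "0 \<le> expectation_at t \<psi>" for t
    using nonneg prob_algebraD_borel_on(3)[OF stage_law_in_prob_algebra[of t]]
    by (intro integral_nonneg_AE AE_I2) (auto simp: \<psi>_def)
  then have "0 \<le> (\<Sum>t. \<alpha> ^ t * expectation_at t \<psi>)"
    using \<alpha> by (intro suminf_nonneg summable_expectations \<psi>m) auto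
  with discounted_cost_eq_value_plus_advantage[OF l V \<psi>_def \<alpha>] show ?thesis
    by simp
qed

text \<open>
  Under a stationary deterministic policy the pair at time \<open>t\<close> lies on the graph of \<open>f\<close>. Stating
  this as invariance of the law under projection to the graph lets integrals be transported
  without arguing about null sets.
\<close>

lemma stationary_stage_law:
  assumes f: "f \<in> borel_on X \<rightarrow>\<^sub>M borel_on A" and \<pi>: "\<pi> = stationary_policy A f"
  shows "stage_law X A Q \<mu> \<pi> t = distr (stage_law X A Q \<mu> \<pi> t) K (\<lambda>\<eta>. (fst \<eta>, f (fst \<eta>)))"
proof -
  let ?g = "\<lambda>x. (x, f x)"
  have "(\<lambda>x. (x, f x)) \<in> borel_on X \<rightarrow>\<^sub>M borel_on X \<Otimes>\<^sub>M borel_on A"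
    by (intro measurable_Pair f measurable_ident_sets refl)
  from measurable_compose[OF this Pair_measurable_borel_on]
  have g: "?g \<in> borel_on X \<rightarrow>\<^sub>M K"
    by simp
  have step: "step_kernel X A Q \<mu> \<pi> t h = distr (state_kernel t h) K ?g"
    if h: "h \<in> space (history_law t)" for h
  proof -
    have "state_kernel t h \<in> space (prob_algebra (borel_on X))"
      using measurable_space[OF measurable_state_kernel, of h] h by (simp add: IT.space_C)
    note S = prob_algebraD_borel_on[OF this]
    have "step_kernel X A Q \<mu> \<pi> t h = state_kernel t h \<bind> (\<lambda>x. return K (?g x))"
      unfolding step_kernel_def
    proof (rule bind_cong[OF refl])
      fix x assume "x \<in> space (state_kernel t h)"
      then have x: "x \<in> X" by (simp only: S)
      then have "f x \<in> space (borel_on A)"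
        using measurable_space[OF f, of x] by (simp add: space_restrict_space)
      then show "distr (\<pi> t (h, x)) K (Pair x) = return K (?g x)"
        using Pair_measurable[OF x] by (simp add: \<pi> stationary_policy_def distr_return)
    qed
    also have "\<dots> = distr (state_kernel t h) K ?g"
      using g prob_space.not_empty[OF S(1)]
      by (intro bind_return_distr') (simp_all only: measurable_cong_sets[OF S(2) refl] not_False_eq_True)
    finally show ?thesis .
  qed
  have "stage_law X A Q \<mu> \<pi> t = history_law t \<bind> (\<lambda>h. distr (state_kernel t h) K ?g)"
    unfolding stage_law_eq_bind by (intro bind_cong refl step)
  also have "\<dots> = distr (history_law t \<bind> state_kernel t) K ?g"
  proof (rule distr_bind[OF _ _ g, symmetric])
    show "state_kernel t \<in> history_law t \<rightarrow>\<^sub>M subprob_algebra (borel_on X)"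
      using measurable_prob_algebraD[OF measurable_state_kernel[of t]]
      by (simp only: measurable_cong_sets[OF sets_history_law refl])
    show "space (history_law t) \<noteq> {}"
      by (intro prob_space.not_empty IT.prob_space_C) simp
  qed
  also have "\<dots> = distr (distr (stage_law X A Q \<mu> \<pi> t) (borel_on X) fst) K ?g"
    by (simp only: distr_stage_law_fst)
  also have "\<dots> = distr (stage_law X A Q \<mu> \<pi> t) K (\<lambda>\<eta>. (fst \<eta>, f (fst \<eta>)))"
    using fst_measurable by (subst distr_distr[OF g]) (auto simp: comp_def stage_law_def)
  finally show ?thesis .
qed

lemma expectation_at_stationary_le:
  assumes f: "f \<in> borel_on X \<rightarrow>\<^sub>M borel_on A" and \<pi>: "\<pi> = stationary_policy A f"
    and \<psi>: "\<psi> \<in> bounded_measurable (X \<times> A)" and le: "\<And>x. x \<in> X \<Longrightarrow> \<psi> (x, f x) \<le> \<epsilon>"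
  shows "expectation_at t \<psi> \<le> \<epsilon>"
proof -
  note P = prob_algebraD_borel_on[OF stage_law_in_prob_algebra[of t]]
  interpret prob_space "stage_law X A Q \<mu> \<pi> t" by (rule P)
  have "(\<lambda>x. (x, f x)) \<in> borel_on X \<rightarrow>\<^sub>M borel_on X \<Otimes>\<^sub>M borel_on A"
    by (intro measurable_Pair f measurable_ident_sets refl)
  from measurable_compose[OF fst_measurable measurable_compose[OF this Pair_measurable_borel_on]]
  have g: "(\<lambda>\<eta>. (fst \<eta>, f (fst \<eta>))) \<in> stage_law X A Q \<mu> \<pi> t \<rightarrow>\<^sub>M K"
    by (simp add: measurable_cong_sets[OF P(2) refl])
  have \<psi>m: "\<psi> \<in> borel_measurable K"
    using \<psi> by (simp add: bounded_measurable_def)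
  have "expectation_at t \<psi> = expectation_at t (\<lambda>\<eta>. \<psi> (fst \<eta>, f (fst \<eta>)))"
    by (subst stationary_stage_law[OF f \<pi>]) (rule integral_distr[OF g \<psi>m])
  also have "\<dots> \<le> \<epsilon>"
  proof (rule integral_le_const)
    have "integrable (distr (stage_law X A Q \<mu> \<pi> t) K (\<lambda>\<eta>. (fst \<eta>, f (fst \<eta>)))) \<psi>"
      using integrable_bounded_measurable[OF \<psi> stage_law_in_prob_algebra]
        stationary_stage_law[OF f \<pi>, of t] by simp
    then show "integrable (stage_law X A Q \<mu> \<pi> t) (\<lambda>\<eta>. \<psi> (fst \<eta>, f (fst \<eta>)))"
      by (simp add: integrable_distr_eq[OF g \<psi>m])
  qed (use le P(3) in \<open>auto intro!: AE_I2\<close>)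
  finally show ?thesis .
qed

text \<open>
  The converse of weak duality up to an error: if the actions lose at most \<open>\<epsilon>\<close> in each stage, the
  total loss is at most the geometric series \<open>\<Sum>t. \<alpha> ^ t * \<epsilon>\<close>.
\<close>

lemma discounted_cost_stationary_le:
  assumes l: "l \<in> bounded_measurable (X \<times> A)" and V: "V \<in> bounded_measurable X"
    and f: "f \<in> borel_on X \<rightarrow>\<^sub>M borel_on A" and \<pi>: "\<pi> = stationary_policy A f"
    and le: "\<And>x. x \<in> X \<Longrightarrow> l (x, f x) + \<alpha> * q_adj Q V (x, f x) \<le> V x + \<epsilon>"
    and \<alpha>: "0 < \<alpha>" "\<alpha> < 1"
  shows "discounted_cost X A Q \<alpha> \<mu> l \<pi> \<le> (\<integral>x. V x \<partial>\<mu>) + \<epsilon> / (1 - \<alpha>)"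
proof -
  define \<psi> where "\<psi> \<eta> = l \<eta> + \<alpha> * q_adj Q V \<eta> - p_adj V \<eta>" for \<eta>
  have \<psi>m: "\<psi> \<in> bounded_measurable (X \<times> A)"
    unfolding \<psi>_def
    by (rule bounded_measurable_advantage[OF l bounded_measurable_q_adj[OF kernel V] bounded_measurable_p_adj[OF V]])
  have "\<psi> (x, f x) \<le> \<epsilon>" if "x \<in> X" for x
    using le[OF that] by (simp add: \<psi>_def p_adj_def)
  from expectation_at_stationary_le[OF f \<pi> \<psi>m this]
  have "expectation_at t \<psi> \<le> \<epsilon>" for t .
  then have "(\<Sum>t. \<alpha> ^ t * expectation_at t \<psi>) \<le> (\<Sum>t. \<alpha> ^ t * \<epsilon>)"
    using \<alpha> by (intro suminf_le summable_expectations \<psi>m summable_mult2 summable_geometric) auto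
  also have "\<dots> = \<epsilon> / (1 - \<alpha>)"
    using \<alpha> by (subst suminf_mult2[symmetric]) (simp_all add: suminf_geometric summable_geometric)
  finally show ?thesis
    using discounted_cost_eq_value_plus_advantage[OF l V \<psi>_def \<alpha>] by simp
qed

text \<open>
  The occupation measure is defined through its values on sets. Presenting it as the image of a
  product measure, with time weighted by the discount factors, makes integrals against it
  computable by the change of variables and Tonelli theorems.
\<close>

abbreviation discounted_stage_law :: "real \<Rightarrow> ('x \<times> 'a) measure" where
  "discounted_stage_law \<alpha> \<equiv>
    distr (density (count_space UNIV \<Otimes>\<^sub>M path_measure X A Q \<mu> \<pi>) (\<lambda>(t, _). ennreal (\<alpha> ^ t)))
      K (\<lambda>(t, \<omega>). \<omega> t)"

lemma nn_integral_discounted_stage_law: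
  assumes h: "h \<in> borel_measurable K"
  shows "(\<integral>\<^sup>+\<eta>. h \<eta> \<partial>discounted_stage_law \<alpha>)
    = (\<Sum>t. ennreal (\<alpha> ^ t) * (\<integral>\<^sup>+\<eta>. h \<eta> \<partial>stage_law X A Q \<mu> \<pi> t))"
proof -
  let ?P = "path_measure X A Q \<mu> \<pi>"
  let ?N = "count_space (UNIV :: nat set) \<Otimes>\<^sub>M ?P" and ?w = "\<lambda>(t, _). ennreal (\<alpha> ^ t)"
  let ?e = "\<lambda>(t, \<omega>). \<omega> t"
  interpret P: prob_space ?P by (rule prob_space_path)
  have e: "?e \<in> ?N \<rightarrow>\<^sub>M K"
    by (intro measurable_pair_measure_countable1) (auto intro: measurable_coordinate)
  have w: "?w \<in> borel_measurable ?N"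
    by (intro measurable_pair_measure_countable1) auto
  have "(\<integral>\<^sup>+\<eta>. h \<eta> \<partial>discounted_stage_law \<alpha>) = (\<integral>\<^sup>+z. h (?e z) \<partial>density ?N ?w)"
    using e h by (intro nn_integral_distr) (simp_all add: measurable_cong_sets[OF sets_density refl])
  also have "\<dots> = (\<integral>\<^sup>+z. ?w z * h (?e z) \<partial>?N)"
    using w measurable_compose[OF e h] by (rule nn_integral_density)
  also have "\<dots> = (\<integral>\<^sup>+t. \<integral>\<^sup>+\<omega>. ennreal (\<alpha> ^ t) * h (\<omega> t) \<partial>?P \<partial>count_space UNIV)"
    using w measurable_compose[OF e h] by (subst P.nn_integral_fst[symmetric]) auto
  also have "\<dots> = (\<integral>\<^sup>+t. ennreal (\<alpha> ^ t) * (\<integral>\<^sup>+\<eta>. h \<eta> \<partial>stage_law X A Q \<mu> \<pi> t) \<partial>count_space UNIV)"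
    using nn_integral_cmult[OF measurable_compose[OF measurable_coordinate h]]
    by (simp add: stage_law_def nn_integral_distr[OF measurable_coordinate] h)
  finally show ?thesis
    by (simp add: nn_integral_count_space_nat)
qed

lemma occupation_measure_eq_discounted_stage_law:
  "occupation_measure X A Q \<alpha> \<mu> \<pi> = discounted_stage_law \<alpha>"
proof (rule measure_eqI)
  have sets: "sets (occupation_measure X A Q \<alpha> \<mu> \<pi>) = sets K"
    using sets.sigma_sets_eq[of K] sets.space_closed[of K]
    by (simp add: occupation_measure_def space_restrict_space)
  then show "sets (occupation_measure X A Q \<alpha> \<mu> \<pi>) = sets (discounted_stage_law \<alpha>)"
    by simp
  fix B assume "B \<in> sets (occupation_measure X A Q \<alpha> \<mu> \<pi>)"
  then have B: "B \<in> sets K"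
    by (simp only: sets)
  have "emeasure (discounted_stage_law \<alpha>) B = (\<integral>\<^sup>+\<eta>. indicator B \<eta> \<partial>discounted_stage_law \<alpha>)"
    using B by simp
  also have "\<dots> = (\<Sum>t. ennreal (\<alpha> ^ t) * (\<integral>\<^sup>+\<eta>. indicator B \<eta> \<partial>stage_law X A Q \<mu> \<pi> t))"
    using B by (intro nn_integral_discounted_stage_law) simp
  also have "\<dots> = emeasure (occupation_measure X A Q \<alpha> \<mu> \<pi>) B"
    using B by (simp add: emeasure_occupation_measure stage_law_def)
  finally show "emeasure (occupation_measure X A Q \<alpha> \<mu> \<pi>) B = emeasure (discounted_stage_law \<alpha>) B" ..
qed

lemma integral_occupation_measure:
  assumes \<psi>: "\<psi> \<in> bounded_measurable (X \<times> A)" and nonneg: "\<And>\<eta>. \<eta> \<in> X \<times> A \<Longrightarrow> \<psi> \<eta> \<ge> 0"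
    and \<alpha>: "0 < \<alpha>" "\<alpha> < 1"
  shows "(\<integral>\<eta>. \<psi> \<eta> \<partial>occupation_measure X A Q \<alpha> \<mu> \<pi>) = (\<Sum>t. \<alpha> ^ t * expectation_at t \<psi>)"
proof -
  let ?O = "discounted_stage_law \<alpha>"
  note sp = prob_algebraD_borel_on(3)[OF stage_law_in_prob_algebra]
  have \<psi>m: "\<psi> \<in> borel_measurable K"
    using \<psi> by (simp add: bounded_measurable_def)
  have E_nonneg: "expectation_at t \<psi> \<ge> 0" for t
    using nonneg sp by (intro integral_nonneg_AE AE_I2) auto
  have E: "(\<integral>\<^sup>+\<eta>. ennreal (\<psi> \<eta>) \<partial>stage_law X A Q \<mu> \<pi> t) = ennreal (expectation_at t \<psi>)" for t
    using nonneg sp integrable_bounded_measurable[OF \<psi> stage_law_in_prob_algebra]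
    by (intro nn_integral_eq_integral AE_I2) auto
  have "(\<integral>\<^sup>+\<eta>. ennreal (\<psi> \<eta>) \<partial>?O) = (\<Sum>t. ennreal (\<alpha> ^ t) * ennreal (expectation_at t \<psi>))"
    using \<psi>m by (simp add: nn_integral_discounted_stage_law E)
  also have "\<dots> = (\<Sum>t. ennreal (\<alpha> ^ t * expectation_at t \<psi>))"
    using \<alpha> E_nonneg by (simp add: ennreal_mult)
  also have "\<dots> = ennreal (\<Sum>t. \<alpha> ^ t * expectation_at t \<psi>)"
    using \<alpha> E_nonneg summable_expectations[OF \<psi> \<alpha>] by (intro suminf_ennreal2) auto
  finally have "(\<integral>\<^sup>+\<eta>. ennreal (\<psi> \<eta>) \<partial>?O) = ennreal (\<Sum>t. \<alpha> ^ t * expectation_at t \<psi>)" .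
  then show ?thesis
    unfolding occupation_measure_eq_discounted_stage_law
    using nonneg \<psi>m \<alpha> E_nonneg summable_expectations[OF \<psi> \<alpha>]
    by (subst integral_eq_nn_integral)
       (auto simp: space_restrict_space intro!: AE_I2 suminf_nonneg enn2real_ennreal)
qed

end


section \<open>Infima over a compact action set\<close>

lemma continuous_bounded_measurable:
  fixes f :: "'a::metric_space \<Rightarrow> real"
  assumes "continuous_on S f" "compact S"
  shows "f \<in> bounded_measurable S"
  using borel_measurable_continuous_on_restrict[OF assms(1)]
    compact_imp_bounded[OF compact_continuous_image[OF assms]]
  by (simp add: bounded_measurable_def)

lemma abs_INF_diff_le:
  fixes f g :: "'a \<Rightarrow> real"
  assumes "A \<noteq> {}" and f: "bdd_below (f ` A)" and g: "bdd_below (g ` A)"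
    and le: "\<And>a. a \<in> A \<Longrightarrow> \<bar>f a - g a\<bar> \<le> e"
  shows "\<bar>(INF a\<in>A. f a) - (INF a\<in>A. g a)\<bar> \<le> e"
proof -
  have "(INF a\<in>A. f a) - e \<le> (INF a\<in>A. g a)"
  proof (rule cINF_greatest[OF \<open>A \<noteq> {}\<close>])
    fix a assume "a \<in> A"
    then show "(INF a\<in>A. f a) - e \<le> g a"
      using cINF_lower[OF f \<open>a \<in> A\<close>] le[of a] by linarith
  qed
  moreover have "(INF a\<in>A. g a) - e \<le> (INF a\<in>A. f a)"
  proof (rule cINF_greatest[OF \<open>A \<noteq> {}\<close>])
    fix a assume "a \<in> A"
    then show "(INF a\<in>A. g a) - e \<le> f a"
      using cINF_lower[OF g \<open>a \<in> A\<close>] le[of a] by linarith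
  qed
  ultimately show ?thesis by linarith
qed

lemma bdd_below_section:
  fixes g :: "'a \<times> 'b \<Rightarrow> real"
  assumes "bounded (g ` (X \<times> A))" "x \<in> X"
  shows "bdd_below ((\<lambda>a. g (x, a)) ` A)"
  by (rule bdd_below_mono[OF bounded_imp_bdd_below[OF assms(1)]]) (use assms(2) in auto)

lemma compact_continuous_modulus:
  assumes S: "compact S" and g: "continuous_on S g" and e: "e > 0"
  obtains d where "d > 0" "\<And>p q. p \<in> S \<Longrightarrow> q \<in> S \<Longrightarrow> dist q p < d \<Longrightarrow> dist (g q) (g p) < e"
proof -
  have "\<exists>d>0. \<forall>p\<in>S. \<forall>q\<in>S. dist q p < d \<longrightarrow> dist (g q) (g p) < e"
    using compact_uniformly_continuous[OF g S] e unfolding uniformly_continuous_on_def by simp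
  then show ?thesis
    using that by auto
qed

text \<open>
  The sections \<open>g (x, _)\<close> depend uniformly continuously on \<open>x\<close>, and the infimum is a
  nonexpansive function of the section in the supremum norm.
\<close>

lemma continuous_on_INF_compact:
  fixes g :: "'x::metric_space \<times> 'a::metric_space \<Rightarrow> real"
  assumes X: "compact X" and A: "compact A" "A \<noteq> {}" and g: "continuous_on (X \<times> A) g"
  shows "continuous_on X (\<lambda>x. INF a\<in>A. g (x, a))"
  unfolding continuous_on_iff
proof (intro ballI allI impI)
  fix x and e :: real assume x: "x \<in> X" and e: "e > 0"
  have XA: "compact (X \<times> A)"
    using X A(1) by (rule compact_Times)
  have bdd: "bounded (g ` (X \<times> A))"
    by (intro compact_imp_bounded compact_continuous_image g XA)
  obtain d where d: "d > 0"
    "\<And>p q. p \<in> X \<times> A \<Longrightarrow> q \<in> X \<times> A \<Longrightarrow> dist q p < d \<Longrightarrow> dist (g q) (g p) < e / 2"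
    using compact_continuous_modulus[OF XA g, of "e / 2"] e by auto
  show "\<exists>d>0. \<forall>y\<in>X. dist y x < d \<longrightarrow> dist (INF a\<in>A. g (y, a)) (INF a\<in>A. g (x, a)) < e"
  proof (intro exI conjI ballI impI)
    fix y assume y: "y \<in> X" "dist y x < d"
    have "\<bar>(INF a\<in>A. g (y, a)) - (INF a\<in>A. g (x, a))\<bar> \<le> e / 2"
    proof (rule abs_INF_diff_le[OF A(2)])
      fix a assume "a \<in> A"
      then show "\<bar>g (y, a) - g (x, a)\<bar> \<le> e / 2"
        using d(2)[of "(x, a)" "(y, a)"] x y by (simp add: dist_Pair_Pair dist_real_def)
    qed (use bdd x y in \<open>auto intro: bdd_below_section\<close>)
    then show "dist (INF a\<in>A. g (y, a)) (INF a\<in>A. g (x, a)) < e"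
      using e by (simp add: dist_real_def)
  qed (rule d)
qed

text \<open>
  An exact minimizer would require a measurable selection theorem. For a near-minimizer a finite
  net of \<open>A\<close> suffices: by uniform continuity every \<open>x\<close> has a near-minimizer in the net, and
  taking the first one in an enumeration of the net is a measurable choice.
\<close>

lemma measurable_near_minimizer:
  fixes g :: "'x::euclidean_space \<times> 'a::euclidean_space \<Rightarrow> real"
  assumes X: "compact X" and A: "compact A" "A \<noteq> {}" and g: "continuous_on (X \<times> A) g"
    and \<epsilon>: "\<epsilon> > 0"
  obtains f where "f \<in> borel_on X \<rightarrow>\<^sub>M borel_on A"
    and "\<And>x. x \<in> X \<Longrightarrow> g (x, f x) \<le> (INF a\<in>A. g (x, a)) + \<epsilon>"
proof -
  let ?m = "\<lambda>x. INF a\<in>A. g (x, a)"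
  have XA: "compact (X \<times> A)"
    using X A(1) by (rule compact_Times)
  obtain d where d: "d > 0"
    "\<And>p q. p \<in> X \<times> A \<Longrightarrow> q \<in> X \<times> A \<Longrightarrow> dist q p < d \<Longrightarrow> dist (g q) (g p) < \<epsilon> / 2"
    using compact_continuous_modulus[OF XA g, of "\<epsilon> / 2"] \<epsilon> by auto
  obtain k where k: "finite k" "k \<subseteq> A" "A \<subseteq> (\<Union>a\<in>k. ball a d)"
    using seq_compact_imp_totally_bounded[of A] A(1) d(1) compact_imp_seq_compact by blast
  obtain c0 and n :: nat where c0: "k = c0 ` {i. i < n}"
    using finite_imp_nat_seg_image_inj_on[OF k(1)] by blast
  obtain a0 where "a0 \<in> A"
    using A(2) by blast
  \<comment> \<open>The enumeration is continued by a point of \<open>A\<close>, so that it maps all indices into \<open>A\<close>.\<close>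
  define c where "c i = (if i < n then c0 i else a0)" for i
  have c: "c i \<in> A" for i
    using k(2) c0 \<open>a0 \<in> A\<close> by (auto simp: c_def)
  have near: "\<exists>i. g (x, c i) \<le> ?m x + \<epsilon>" if x: "x \<in> X" for x
  proof -
    have "bdd_below ((\<lambda>a. g (x, a)) ` A)"
      using x by (intro bdd_below_section[where X=X] compact_imp_bounded compact_continuous_image g XA)
    then have "\<exists>a\<in>A. g (x, a) < ?m x + \<epsilon> / 2"
      using A(2) \<epsilon> by (simp add: cINF_less_iff[symmetric])
    then obtain a where a: "a \<in> A" "g (x, a) < ?m x + \<epsilon> / 2"
      by blast
    then obtain b where b: "b \<in> k" "dist b a < d"
      using k(3) by auto
    then obtain i where "i < n" "c0 i = b"
      using c0 by blast
    then have i: "c i = b"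
      by (simp add: c_def)
    have "dist (g (x, b)) (g (x, a)) < \<epsilon> / 2"
      using d(2)[of "(x, a)" "(x, b)"] x a(1) b c[of i] i
      by (simp add: dist_Pair_Pair)
    then have "g (x, b) < g (x, a) + \<epsilon> / 2"
      unfolding dist_real_def by linarith
    with a(2) i show ?thesis
      by (intro exI[of _ i]) simp
  qed
  have cont_c: "continuous_on X (\<lambda>x. g (x, c i))" for i
    by (rule continuous_on_compose2[OF g]) (use c in \<open>auto intro!: continuous_intros\<close>)
  have "Measurable.pred (borel_on X) (\<lambda>x. g (x, c i) \<le> ?m x + \<epsilon>)" for i
    using borel_measurable_continuous_on_restrict[OF cont_c[of i]]
      borel_measurable_continuous_on_restrict[OF continuous_on_INF_compact[OF X A g]]
    by measurable
  then have least: "(\<lambda>x. LEAST i. g (x, c i) \<le> ?m x + \<epsilon>) \<in> borel_on X \<rightarrow>\<^sub>M count_space UNIV"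
    by (rule measurable_Least)
  have "c \<in> count_space UNIV \<rightarrow>\<^sub>M borel_on A"
    using c by (auto simp: space_restrict_space)
  from measurable_compose[OF least this] show ?thesis
  proof (rule that)
    fix x assume "x \<in> X"
    from LeastI_ex[OF near[OF this]]
    show "g (x, c (LEAST i. g (x, c i) \<le> ?m x + \<epsilon>)) \<le> ?m x + \<epsilon>" .
  qed
qed

section \<open>The Bellman equation and the optimal value function\<close>

text \<open>
  Rescaling \<open>f\<close> by its bound makes it a competitor in the supremum that defines the distance; the
  bound is taken strictly positive for this division.
\<close>

lemma integral_diff_le_tv_dist:
  fixes f :: "'a::topological_space \<Rightarrow> real"
  assumes f: "f \<in> bounded_measurable S"
    and M: "M \<in> space (prob_algebra (borel_on S))" and N: "N \<in> space (prob_algebra (borel_on S))"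
    and B: "B > 0" "\<And>x. x \<in> S \<Longrightarrow> \<bar>f x\<bar> \<le> B"
  shows "(\<integral>x. f x \<partial>M) - (\<integral>x. f x \<partial>N) \<le> B * tv_dist M N"
proof -
  note PM = prob_algebraD_borel_on[OF M]
  let ?U = "{v :: 'a \<Rightarrow> real. v \<in> borel_measurable M \<and> (\<forall>x\<in>space M. \<bar>v x\<bar> \<le> 1)}"
  have U: "v \<in> bounded_measurable S" "\<And>x. x \<in> S \<Longrightarrow> \<bar>v x\<bar> \<le> 1" if "v \<in> ?U" for v
    using that PM(3) by (auto simp: measurable_cong_sets[OF PM(2) refl] intro: bounded_measurableI)
  have "bdd_above ((\<lambda>v. (\<integral>x. v x \<partial>M) - (\<integral>x. v x \<partial>N)) ` ?U)"
  proof (rule bdd_aboveI2)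
    fix v assume v: "v \<in> ?U"
    have "\<bar>\<integral>x. v x \<partial>M\<bar> \<le> 1" "\<bar>\<integral>x. v x \<partial>N\<bar> \<le> 1"
      using abs_integral_le_bound[OF U(1)[OF v] M U(2)[OF v]]
        abs_integral_le_bound[OF U(1)[OF v] N U(2)[OF v]] by auto
    then show "(\<integral>x. v x \<partial>M) - (\<integral>x. v x \<partial>N) \<le> 2"
      by linarith
  qed
  moreover have "(\<lambda>x. f x / B) \<in> ?U"
    using f B PM(3) by (auto simp: bounded_measurable_def measurable_cong_sets[OF PM(2) refl])
  ultimately have "(\<integral>x. f x / B \<partial>M) - (\<integral>x. f x / B \<partial>N) \<le> tv_dist M N"
    unfolding tv_dist_def by (intro cSUP_upper)
  then have "((\<integral>x. f x \<partial>M) - (\<integral>x. f x \<partial>N)) / B \<le> tv_dist M N"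
    by (simp add: diff_divide_distrib)
  then show ?thesis
    using B(1) by (simp add: divide_le_eq mult.commute)
qed

lemma stationary_policy_in_policies:
  assumes f: "f \<in> borel_on X \<rightarrow>\<^sub>M borel_on A"
  shows "stationary_policy A f \<in> policies X A"
proof -
  have "(\<lambda>p. return (borel_on A) (f (snd p)))
      \<in> (PiM {0..<t} (\<lambda>_. borel_on (X \<times> A))) \<Otimes>\<^sub>M borel_on X \<rightarrow>\<^sub>M prob_algebra (borel_on A)" for t :: nat
    by (rule measurable_compose[OF measurable_compose[OF measurable_snd f] measurable_return_prob_space])
  then show ?thesis
    by (simp add: policies_def stationary_policy_def case_prod_unfold)
qed

locale markov_decision_process =
  fixes X :: "'x::euclidean_space set" and A :: "'a::euclidean_space set"
    and Q :: "'x \<times> 'a \<Rightarrow> 'x measure" and \<alpha> L :: real and l :: "'x \<times> 'a \<Rightarrow> real"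
  assumes compact_X: "compact X" and compact_A: "compact A" and A_nonempty: "A \<noteq> {}"
    and Q_kernel: "Q \<in> borel_on (X \<times> A) \<rightarrow>\<^sub>M prob_algebra (borel_on X)"
    and L_nonneg: "L \<ge> 0"
    and Q_lipschitz: "\<And>\<eta> \<eta>'. \<eta> \<in> X \<times> A \<Longrightarrow> \<eta>' \<in> X \<times> A \<Longrightarrow> tv_dist (Q \<eta>) (Q \<eta>') \<le> L * norm (\<eta> - \<eta>')"
    and discount: "0 < \<alpha>" "\<alpha> < 1"
    and cost_continuous: "continuous_on (X \<times> A) l"
begin

lemma Q_space: "\<eta> \<in> X \<times> A \<Longrightarrow> Q \<eta> \<in> space (prob_algebra (borel_on X))"
  using measurable_space[OF Q_kernel] by (simp add: space_restrict_space)

text \<open>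
  The smoothing property of the kernel: the total variation distance controls the integrals of all
  functions with a common bound, so \<open>q_adj Q V\<close> is Lipschitz even when \<open>V\<close> is discontinuous.
\<close>

lemma continuous_on_q_adj:
  assumes V: "V \<in> bounded_measurable X"
  shows "continuous_on (X \<times> A) (q_adj Q V)"
proof -
  obtain B0 where "\<And>x. x \<in> X \<Longrightarrow> \<bar>V x\<bar> \<le> B0"
    using bounded_measurable_bound[OF V] by metis
  then obtain B where B: "B > 0" "\<And>x. x \<in> X \<Longrightarrow> \<bar>V x\<bar> \<le> B"
    by (meson max.strict_coboundedI1 max.coboundedI2 zero_less_one)
  have le: "q_adj Q V \<eta> - q_adj Q V \<eta>' \<le> B * L * dist \<eta> \<eta>'" if "\<eta> \<in> X \<times> A" "\<eta>' \<in> X \<times> A" for \<eta> \<eta>'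
  proof -
    have "q_adj Q V \<eta> - q_adj Q V \<eta>' \<le> B * tv_dist (Q \<eta>) (Q \<eta>')"
      unfolding q_adj_def using that by (intro integral_diff_le_tv_dist[OF V Q_space Q_space B])
    also have "\<dots> \<le> B * (L * dist \<eta> \<eta>')"
      using Q_lipschitz[OF that] B(1) by (simp add: dist_norm)
    finally show ?thesis by (simp add: mult.assoc)
  qed
  have "(B * L)-lipschitz_on (X \<times> A) (q_adj Q V)"
  proof (rule lipschitz_onI)
    fix \<eta> \<eta>' assume "\<eta> \<in> X \<times> A" "\<eta>' \<in> X \<times> A"
    then show "dist (q_adj Q V \<eta>) (q_adj Q V \<eta>') \<le> B * L * dist \<eta> \<eta>'"
      using le[of \<eta> \<eta>'] le[of \<eta>' \<eta>] by (simp add: dist_real_def dist_commute)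
  qed (use B(1) L_nonneg in simp)
  then show ?thesis
    by (rule lipschitz_on_continuous_on)
qed

definition action_value :: "('x \<Rightarrow> real) \<Rightarrow> 'x \<times> 'a \<Rightarrow> real" where
  "action_value V \<eta> = l \<eta> + \<alpha> * q_adj Q V \<eta>"

definition bellman :: "('x \<Rightarrow> real) \<Rightarrow> 'x \<Rightarrow> real" where
  "bellman V x = (INF a\<in>A. action_value V (x, a))"

lemma continuous_on_action_value:
  "V \<in> bounded_measurable X \<Longrightarrow> continuous_on (X \<times> A) (action_value V)"
  unfolding action_value_def by (intro continuous_intros cost_continuous continuous_on_q_adj)

lemma bdd_below_action_value:
  assumes "V \<in> bounded_measurable X" "x \<in> X"
  shows "bdd_below ((\<lambda>a. action_value V (x, a)) ` A)"
  using assms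
  by (intro bdd_below_section[where X=X] compact_imp_bounded compact_continuous_image
        continuous_on_action_value compact_Times compact_X compact_A)

lemma continuous_on_bellman:
  assumes "V \<in> bounded_measurable X" shows "continuous_on X (bellman V)"
  using continuous_on_INF_compact[OF compact_X compact_A A_nonempty continuous_on_action_value[OF assms]]
  by (simp add: bellman_def[abs_def])

text \<open>
  Integrating against probability measures and taking infima do not enlarge uniform distances, so
  the discount factor remains as the modulus.
\<close>

lemma bellman_contraction:
  assumes V: "V \<in> bounded_measurable X" and W: "W \<in> bounded_measurable X"
    and e: "\<And>x. x \<in> X \<Longrightarrow> \<bar>V x - W x\<bar> \<le> e" and x: "x \<in> X"
  shows "\<bar>bellman V x - bellman W x\<bar> \<le> \<alpha> * e"
  unfolding bellman_def
proof (rule abs_INF_diff_le[OF A_nonempty bdd_below_action_value[OF V x] bdd_below_action_value[OF W x]])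
  fix a assume "a \<in> A"
  with x have \<eta>: "(x, a) \<in> X \<times> A" by simp
  have VW: "(\<lambda>x. V x - W x) \<in> bounded_measurable X"
    using V W e by (intro bounded_measurableI[where B=e]) (auto simp: bounded_measurable_def)
  have "\<bar>\<integral>y. V y - W y \<partial>Q (x, a)\<bar> \<le> e"
    by (rule abs_integral_le_bound[OF VW Q_space[OF \<eta>] e])
  moreover have "(\<integral>y. V y - W y \<partial>Q (x, a)) = q_adj Q V (x, a) - q_adj Q W (x, a)"
    using integrable_bounded_measurable[OF V Q_space[OF \<eta>]] integrable_bounded_measurable[OF W Q_space[OF \<eta>]]
    by (simp add: q_adj_def)
  ultimately have "\<alpha> * \<bar>q_adj Q V (x, a) - q_adj Q W (x, a)\<bar> \<le> \<alpha> * e"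
    using discount by simp
  then show "\<bar>action_value V (x, a) - action_value W (x, a)\<bar> \<le> \<alpha> * e"
    using discount by (simp add: action_value_def abs_mult flip: right_diff_distrib)
qed

primrec value_iteration :: "nat \<Rightarrow> 'x \<Rightarrow> real" where
  "value_iteration 0 = (\<lambda>_. 0)"
| "value_iteration (Suc n) = bellman (value_iteration n)"

lemma continuous_on_value_iteration: "continuous_on X (value_iteration n)"
proof (induction n)
  case (Suc n)
  then show ?case
    using continuous_on_bellman continuous_bounded_measurable[OF _ compact_X] by simp
qed simp

text \<open>
  By the contraction property the increments of value iteration are dominated by a geometric
  series. Hence the iterates converge uniformly on \<open>X\<close>, which preserves continuity and permits
  passing to the limit in the recursion.
\<close>

lemma bellman_fixed_point:
  obtains V where "continuous_on X V" and "\<And>x. x \<in> X \<Longrightarrow> bellman V x = V x"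
proof -
  let ?v = value_iteration
  have vm: "?v n \<in> bounded_measurable X" for n
    by (rule continuous_bounded_measurable[OF continuous_on_value_iteration compact_X])
  obtain C where C: "\<And>x. x \<in> X \<Longrightarrow> \<bar>?v 1 x\<bar> \<le> C"
    using bounded_measurable_bound[OF vm[of 1]] by metis
  have step: "\<bar>?v (Suc n) x - ?v n x\<bar> \<le> \<alpha> ^ n * C" if "x \<in> X" for n x
    using that
  proof (induction n arbitrary: x)
    case (Suc n)
    then show ?case
      using bellman_contraction[OF vm[of "Suc n"] vm[of n] Suc.IH Suc.prems] by (simp add: mult.assoc)
  qed (use C in simp)
  \<comment> \<open>The iteration starts at 0, so the limit is the sum of the increments.\<close>
  define V where "V x = (\<Sum>n. ?v (Suc n) x - ?v n x)" for x
  have "uniform_limit X (\<lambda>n x. \<Sum>i<n. ?v (Suc i) x - ?v i x) V sequentially"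
    unfolding V_def using step discount
    by (intro Weierstrass_m_test[where M="\<lambda>n. \<alpha> ^ n * C"] summable_mult2 summable_geometric) auto
  moreover have "(\<lambda>n x. \<Sum>i<n. ?v (Suc i) x - ?v i x) = ?v"
    using sum_lessThan_telescope[of "\<lambda>i. ?v i _"] by (intro ext) simp
  ultimately have lim: "uniform_limit X ?v V sequentially"
    by (simp only:)
  have cont: "continuous_on X V"
    by (rule uniform_limit_theorem[OF _ lim]) (simp_all add: continuous_on_value_iteration)
  note Vm = continuous_bounded_measurable[OF cont compact_X]
  have "bellman V x = V x" if x: "x \<in> X" for x
  proof -
    have "(\<lambda>n. ?v (Suc n) x) \<longlonglongrightarrow> bellman V x"
    proof (rule tendstoI)
      fix e :: real assume e: "e > 0"
      have "\<forall>\<^sub>F n in sequentially. \<forall>y\<in>X. dist (?v n y) (V y) < e"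
        using lim e by (rule uniform_limitD)
      then show "\<forall>\<^sub>F n in sequentially. dist (?v (Suc n) x) (bellman V x) < e"
      proof eventually_elim
        case (elim n)
        then have "\<bar>?v n y - V y\<bar> \<le> e" if "y \<in> X" for y
          using that by (force simp: dist_real_def)
        from bellman_contraction[OF vm Vm this x]
        have "dist (?v (Suc n) x) (bellman V x) \<le> \<alpha> * e"
          by (simp add: dist_real_def)
        also have "\<dots> < e"
          using e discount by simp
        finally show ?case .
      qed
    qed
    moreover have "(\<lambda>n. ?v (Suc n) x) \<longlonglongrightarrow> V x"
      by (intro LIMSEQ_Suc tendsto_uniform_limitI[OF lim x])
    ultimately show ?thesis
      by (rule LIMSEQ_unique)
  qed
  with cont show ?thesis
    by (rule that)
qed

lemma cost_bounded_measurable: "l \<in> bounded_measurable (X \<times> A)"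
  by (rule continuous_bounded_measurable[OF cost_continuous compact_Times[OF compact_X compact_A]])

text \<open>
  All three facts are transferred from a continuous solution \<open>V\<close> of the Bellman equation, which is
  squeezed between lower and upper bounds for the cost from an arbitrary initial law. Dirac initial
  laws identify \<open>V\<close> with the optimal value function; the given initial law yields the last fact.
\<close>

lemma optimal_value_bellman:
  shows optimal_value_bounded_measurable: "optimal_value X A Q \<alpha> l \<in> bounded_measurable X"
    and optimal_value_advantage_nonneg: "\<eta> \<in> X \<times> A \<Longrightarrow>
      0 \<le> l \<eta> + \<alpha> * q_adj Q (optimal_value X A Q \<alpha> l) \<eta> - p_adj (optimal_value X A Q \<alpha> l) \<eta>"
    and optimal_policy_cost_le: "\<mu> \<in> space (prob_algebra (borel_on X)) \<Longrightarrow> optimal_policy X A Q \<alpha> \<mu> l \<pi> \<Longrightarrow>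
      discounted_cost X A Q \<alpha> \<mu> l \<pi> \<le> (\<integral>x. optimal_value X A Q \<alpha> l x \<partial>\<mu>)"
proof -
  obtain V where cont: "continuous_on X V" and fix_V: "\<And>x. x \<in> X \<Longrightarrow> bellman V x = V x"
    using bellman_fixed_point by metis
  have Vm: "V \<in> bounded_measurable X"
    by (rule continuous_bounded_measurable[OF cont compact_X])
  note l = cost_bounded_measurable
  have nonneg: "0 \<le> l \<eta> + \<alpha> * q_adj Q V \<eta> - p_adj V \<eta>" if \<eta>: "\<eta> \<in> X \<times> A" for \<eta>
  proof -
    obtain x a where xa: "\<eta> = (x, a)" "x \<in> X" "a \<in> A"
      using \<eta> by blast
    then have "bellman V x \<le> action_value V (x, a)"
      unfolding bellman_def by (intro cINF_lower bdd_below_action_value[OF Vm])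
    then show ?thesis
      using xa fix_V by (simp add: action_value_def p_adj_def)
  qed
  have lower: "(\<integral>x. V x \<partial>\<mu>) \<le> discounted_cost X A Q \<alpha> \<mu> l \<pi>"
    if "\<mu> \<in> space (prob_algebra (borel_on X))" "\<pi> \<in> policies X A" for \<mu> \<pi>
  proof -
    interpret controlled_process X A Q \<mu> \<pi>
      using Q_kernel that by unfold_locales
    show ?thesis
      by (rule integral_le_discounted_cost[OF l Vm nonneg discount])
  qed
  have upper: "\<exists>\<pi>\<in>policies X A. discounted_cost X A Q \<alpha> \<mu> l \<pi> \<le> (\<integral>x. V x \<partial>\<mu>) + \<epsilon>"
    if \<mu>: "\<mu> \<in> space (prob_algebra (borel_on X))" and \<epsilon>: "\<epsilon> > 0" for \<mu> \<epsilon>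
  proof -
    \<comment> \<open>A loss of \<open>\<delta>\<close> in every stage accumulates to \<open>\<epsilon>\<close>.\<close>
    define \<delta> where "\<delta> = \<epsilon> * (1 - \<alpha>)"
    have "\<delta> > 0"
      using \<epsilon> discount by (simp add: \<delta>_def)
    from measurable_near_minimizer[OF compact_X compact_A A_nonempty continuous_on_action_value[OF Vm] this]
    obtain f where f: "f \<in> borel_on X \<rightarrow>\<^sub>M borel_on A"
      and f_le: "\<And>x. x \<in> X \<Longrightarrow> action_value V (x, f x) \<le> bellman V x + \<delta>"
      unfolding bellman_def by metis
    note pol = stationary_policy_in_policies[OF f]
    interpret controlled_process X A Q \<mu> "stationary_policy A f"
      using Q_kernel \<mu> pol by unfold_locales
    have "discounted_cost X A Q \<alpha> \<mu> l (stationary_policy A f) \<le> (\<integral>x. V x \<partial>\<mu>) + \<delta> / (1 - \<alpha>)"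
      using f_le fix_V
      by (intro discounted_cost_stationary_le[OF l Vm f refl _ discount]) (simp add: action_value_def)
    also have "\<delta> / (1 - \<alpha>) = \<epsilon>"
      using discount by (simp add: \<delta>_def)
    finally show ?thesis
      using pol by blast
  qed
  have value_eq: "optimal_value X A Q \<alpha> l x = V x" if x: "x \<in> X" for x
  proof -
    let ?\<delta> = "return (borel_on X) x"
    have \<delta>: "?\<delta> \<in> space (prob_algebra (borel_on X))"
      using x by (simp add: space_prob_algebra space_restrict_space prob_space_return)
    have int: "(\<integral>y. V y \<partial>?\<delta>) = V x"
      using x Vm by (intro integral_return) (auto simp: space_restrict_space bounded_measurable_def)
    have bdd: "bdd_below (discounted_cost X A Q \<alpha> ?\<delta> l ` policies X A)"
      using lower[OF \<delta>] by (auto intro!: bdd_belowI2)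
    show ?thesis
      unfolding optimal_value_def
    proof (rule antisym)
      show "(INF \<pi>\<in>policies X A. discounted_cost X A Q \<alpha> ?\<delta> l \<pi>) \<le> V x"
      proof (rule field_le_epsilon)
        fix \<epsilon> :: real assume "\<epsilon> > 0"
        from upper[OF \<delta> this] obtain \<pi> where "\<pi> \<in> policies X A"
          "discounted_cost X A Q \<alpha> ?\<delta> l \<pi> \<le> V x + \<epsilon>"
          by (auto simp: int)
        then show "(INF \<pi>\<in>policies X A. discounted_cost X A Q \<alpha> ?\<delta> l \<pi>) \<le> V x + \<epsilon>"
          by (intro cINF_lower2[OF bdd])
      qed
      show "V x \<le> (INF \<pi>\<in>policies X A. discounted_cost X A Q \<alpha> ?\<delta> l \<pi>)"
        using upper[OF \<delta>, of 1] lower[OF \<delta>] by (intro cINF_greatest) (auto simp: int)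
    qed
  qed
  show m: "optimal_value X A Q \<alpha> l \<in> bounded_measurable X"
  proof -
    have "continuous_on X (optimal_value X A Q \<alpha> l)"
      using cont by (simp add: value_eq cong: continuous_on_cong)
    then show ?thesis
      by (rule continuous_bounded_measurable[OF _ compact_X])
  qed
  have int_eq: "(\<integral>x. optimal_value X A Q \<alpha> l x \<partial>\<mu>) = (\<integral>x. V x \<partial>\<mu>)"
    if "\<mu> \<in> space (prob_algebra (borel_on X))" for \<mu>
    using prob_algebraD_borel_on(3)[OF that] value_eq
    by (intro Bochner_Integration.integral_cong) auto
  show "0 \<le> l \<eta> + \<alpha> * q_adj Q (optimal_value X A Q \<alpha> l) \<eta> - p_adj (optimal_value X A Q \<alpha> l) \<eta>"
    if \<eta>: "\<eta> \<in> X \<times> A" for \<eta>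
    using nonneg[OF \<eta>] \<eta> int_eq[OF Q_space[OF \<eta>]] value_eq[of "fst \<eta>"]
    by (auto simp: q_adj_def p_adj_def)
  show "discounted_cost X A Q \<alpha> \<mu> l \<pi> \<le> (\<integral>x. optimal_value X A Q \<alpha> l x \<partial>\<mu>)"
    if \<mu>: "\<mu> \<in> space (prob_algebra (borel_on X))" and opt: "optimal_policy X A Q \<alpha> \<mu> l \<pi>" for \<mu> \<pi>
  proof (rule field_le_epsilon)
    fix \<epsilon> :: real assume "\<epsilon> > 0"
    with upper[OF \<mu>] obtain \<pi>' where "\<pi>' \<in> policies X A"
      "discounted_cost X A Q \<alpha> \<mu> l \<pi>' \<le> (\<integral>x. V x \<partial>\<mu>) + \<epsilon>"
      by blast
    then show "discounted_cost X A Q \<alpha> \<mu> l \<pi> \<le> (\<integral>x. optimal_value X A Q \<alpha> l x \<partial>\<mu>) + \<epsilon>"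
      using opt int_eq[OF \<mu>] by (fastforce simp: optimal_policy_def is_arg_min_linorder)
  qed
qed

end


section \<open>The inverse problem\<close>

theorem proposition3p2:
  fixes xmin xmax :: "real ^ 'nx" and amin amax :: "real ^ 'na"
    and X :: "(real ^ 'nx) set" and A :: "(real ^ 'na) set"
    and Q :: "(real ^ 'nx) \<times> (real ^ 'na) \<Rightarrow> (real ^ 'nx) measure"
    and \<phi> :: "(real ^ 'nx) \<times> (real ^ 'na) \<Rightarrow> real ^ 'nl"
    and \<theta>bar :: "real ^ 'nl"
    and lbar \<psi>bar :: "(real ^ 'nx) \<times> (real ^ 'na) \<Rightarrow> real"
    and Vbar :: "real ^ 'nx \<Rightarrow> real"
    and \<mu>\<^sub>1 :: "(real ^ 'nx) measure"
    and \<pi>bar :: "real ^ 'nx \<Rightarrow> real ^ 'na"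
    and L\<^sub>Q L\<^sub>\<phi> \<alpha> \<beta>\<^sub>l \<beta>\<^sub>\<psi> \<beta>\<^sub>V :: real
  assumes X: "X = cbox xmin xmax" and A: "A = cbox amin amax"
    and Q_kernel: "Q \<in> borel_on (X \<times> A) \<rightarrow>\<^sub>M prob_algebra (borel_on X)"
    and L\<^sub>Q_nonneg: "L\<^sub>Q \<ge> 0"
    and Q_lipschitz:
      "\<forall>\<eta>\<^sub>1\<in>X \<times> A. \<forall>\<eta>\<^sub>2\<in>X \<times> A. tv_dist (Q \<eta>\<^sub>1) (Q \<eta>\<^sub>2) \<le> L\<^sub>Q * norm (\<eta>\<^sub>1 - \<eta>\<^sub>2)"
    and \<phi>_lipschitz: "\<forall>i. L\<^sub>\<phi>-lipschitz_on (X \<times> A) (\<lambda>\<eta>. \<phi> \<eta> $ i)"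
    and lbar: "lbar = (\<lambda>\<eta>. \<theta>bar \<bullet> \<phi> \<eta>)"
    and \<alpha>: "0 < \<alpha>" "\<alpha> < 1"
    and \<mu>\<^sub>1_prob: "\<mu>\<^sub>1 \<in> space (prob_algebra (borel_on X))"
    and \<mu>\<^sub>1_support: "measure_support \<mu>\<^sub>1 = X"
    and \<pi>bar_measurable: "\<pi>bar \<in> borel_on X \<rightarrow>\<^sub>M borel_on A"
    and \<pi>bar_optimal: "optimal_policy X A Q \<alpha> \<mu>\<^sub>1 lbar (stationary_policy A \<pi>bar)"
    and Vbar: "Vbar = optimal_value X A Q \<alpha> lbar"
    and normalization:
      "(LINT \<eta>:X \<times> A|lborel. lbar \<eta> - Vbar (fst \<eta>) + \<alpha> * (\<integral>y. Vbar y \<partial>Q \<eta>)) \<ge> 1"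
    and \<psi>bar: "\<psi>bar = (\<lambda>\<eta>. lbar \<eta> + \<alpha> * q_adj Q Vbar \<eta> - p_adj Vbar \<eta>)"
    and \<beta>\<^sub>l: "l1_norm \<theta>bar \<le> \<beta>\<^sub>l"
    and \<beta>\<^sub>\<psi>: "sup_norm (X \<times> A) \<psi>bar \<le> \<beta>\<^sub>\<psi>"
    and \<beta>\<^sub>V: "sup_norm X Vbar \<le> \<beta>\<^sub>V"
  defines "feasible \<equiv> ioc_feasible X A Q \<alpha> \<phi> \<beta>\<^sub>l \<beta>\<^sub>\<psi> \<beta>\<^sub>V"
    and "objective \<equiv>
      ioc_objective (occupation_measure X A Q \<alpha> \<mu>\<^sub>1 (stationary_policy A \<pi>bar))"
  shows "(\<exists>z. is_arg_min objective feasible z) \<and>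
    (INF z\<in>Collect feasible. objective z) = 0 \<and>
    (\<forall>\<theta> V \<psi>. is_arg_min objective feasible (\<theta>, V, \<psi>) \<longrightarrow>
      optimal_policy X A Q \<alpha> \<mu>\<^sub>1 (\<lambda>\<eta>. \<theta> \<bullet> \<phi> \<eta>) (stationary_policy A \<pi>bar))"
proof -
  let ?\<pi> = "stationary_policy A \<pi>bar"
  let ?cost = "\<lambda>\<theta>. discounted_cost X A Q \<alpha> \<mu>\<^sub>1 (\<lambda>\<eta>. \<theta> \<bullet> \<phi> \<eta>)"
  have compact: "compact X" "compact A" "compact (X \<times> A)"
    unfolding X A by (auto intro: compact_Times)
  have X_ne: "X \<noteq> {}"
    using prob_space.not_empty prob_algebraD_borel_on[OF \<mu>\<^sub>1_prob] by metis
  then obtain x0 where "x0 \<in> X"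
    by blast
  then have "\<pi>bar x0 \<in> A"
    using measurable_space[OF \<pi>bar_measurable, of x0] by (simp add: space_restrict_space)
  then have A_ne: "A \<noteq> {}"
    by blast
  have \<pi>_pol: "?\<pi> \<in> policies X A"
    by (rule stationary_policy_in_policies[OF \<pi>bar_measurable])
  have cost_cont: "continuous_on (X \<times> A) (\<lambda>\<eta>. \<theta> \<bullet> \<phi> \<eta>)" for \<theta>
  proof -
    have "continuous_on (X \<times> A) (\<lambda>\<eta>. \<phi> \<eta> $ i)" for i
      using \<phi>_lipschitz lipschitz_on_continuous_on by blast
    then show ?thesis
      unfolding inner_vec_def inner_real_def
      by (intro continuous_on_sum continuous_on_mult continuous_on_const)
  qed
  note cost_m = continuous_bounded_measurable[OF cost_cont compact(3)]
  interpret controlled_process X A Q \<mu>\<^sub>1 ?\<pi>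
    by unfold_locales (rule Q_kernel \<mu>\<^sub>1_prob \<pi>_pol)+
  interpret mdp: markov_decision_process X A Q \<alpha> L\<^sub>Q lbar
    unfolding lbar using Q_lipschitz A_ne
    by unfold_locales (auto intro: compact Q_kernel L\<^sub>Q_nonneg \<alpha> cost_cont)
  \<comment> \<open>The objective is the gap of the expert in the weak duality inequality.\<close>
  have objective: "objective (\<theta>, V, \<psi>) = ?cost \<theta> ?\<pi> - (\<integral>x. V x \<partial>\<mu>\<^sub>1)"
    and lower: "\<And>\<pi>. \<pi> \<in> policies X A \<Longrightarrow> (\<integral>x. V x \<partial>\<mu>\<^sub>1) \<le> ?cost \<theta> \<pi>"
    if "feasible (\<theta>, V, \<psi>)" for \<theta> V \<psi>
  proof -
    from that have V: "V \<in> bounded_measurable X" and \<psi>m: "\<psi> \<in> bounded_measurable (X \<times> A)"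
      and \<psi>: "\<And>\<eta>. \<eta> \<in> X \<times> A \<Longrightarrow> \<psi> \<eta> = \<theta> \<bullet> \<phi> \<eta> + \<alpha> * q_adj Q V \<eta> - p_adj V \<eta>"
      and nonneg: "\<And>\<eta>. \<eta> \<in> X \<times> A \<Longrightarrow> \<psi> \<eta> \<ge> 0"
      by (auto simp: feasible_def ioc_feasible_def)
    show "objective (\<theta>, V, \<psi>) = ?cost \<theta> ?\<pi> - (\<integral>x. V x \<partial>\<mu>\<^sub>1)"
      using integral_occupation_measure[OF \<psi>m nonneg \<alpha>]
        discounted_cost_eq_value_plus_advantage[OF cost_m V \<psi> \<alpha>]
      by (simp add: objective_def ioc_objective_def)
    fix \<pi> assume "\<pi> \<in> policies X A"
    then interpret \<pi>: controlled_process X A Q \<mu>\<^sub>1 \<pi>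
      by unfold_locales (rule Q_kernel \<mu>\<^sub>1_prob)+
    show "(\<integral>x. V x \<partial>\<mu>\<^sub>1) \<le> ?cost \<theta> \<pi>"
      using \<psi> nonneg by (intro \<pi>.integral_le_discounted_cost[OF cost_m V _ \<alpha>]) metis
  qed
  let ?z = "(\<theta>bar, Vbar, \<psi>bar)"
  \<comment> \<open>The true cost with its optimal value function is the point that attains the value 0.\<close>
  have feas: "feasible ?z"
  proof -
    have Vm: "Vbar \<in> bounded_measurable X"
      unfolding Vbar by (rule mdp.optimal_value_bounded_measurable)
    have "\<psi>bar \<in> bounded_measurable (X \<times> A)"
      unfolding \<psi>bar by (rule bounded_measurable_advantage[OF mdp.cost_bounded_measurable
            bounded_measurable_q_adj[OF Q_kernel Vm] bounded_measurable_p_adj[OF Vm]])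
    moreover have "\<forall>\<eta>\<in>X \<times> A. \<psi>bar \<eta> \<ge> 0"
      unfolding \<psi>bar Vbar using mdp.optimal_value_advantage_nonneg by blast
    moreover have "(LINT \<eta>:X \<times> A|lborel. \<psi>bar \<eta>) \<ge> 1"
      using normalization by (simp add: \<psi>bar q_adj_def p_adj_def algebra_simps)
    moreover have "\<forall>\<eta>\<in>X \<times> A. \<psi>bar \<eta> = \<theta>bar \<bullet> \<phi> \<eta> + \<alpha> * q_adj Q Vbar \<eta> - p_adj Vbar \<eta>"
      by (simp add: \<psi>bar lbar)
    ultimately show ?thesis
      unfolding feasible_def ioc_feasible_def using Vm \<beta>\<^sub>l \<beta>\<^sub>\<psi> \<beta>\<^sub>V by simp
  qed
  have nonneg: "objective z \<ge> 0" if "feasible z" for z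
    using that objective lower \<pi>_pol by (cases z) fastforce
  have zero: "objective ?z = 0"
  proof (rule antisym)
    have "?cost \<theta>bar ?\<pi> \<le> (\<integral>x. Vbar x \<partial>\<mu>\<^sub>1)"
      using mdp.optimal_policy_cost_le[OF \<mu>\<^sub>1_prob \<pi>bar_optimal] by (simp add: Vbar lbar)
    then show "objective ?z \<le> 0"
      by (simp add: objective[OF feas])
  qed (rule nonneg[OF feas])
  have "is_arg_min objective feasible ?z"
    using feas zero nonneg by (simp add: is_arg_min_linorder)
  moreover have "(INF z\<in>Collect feasible. objective z) = 0"
    using feas zero nonneg by (intro cInf_eq_minimum) (auto intro: image_eqI[where x="?z"])
  moreover have "optimal_policy X A Q \<alpha> \<mu>\<^sub>1 (\<lambda>\<eta>. \<theta> \<bullet> \<phi> \<eta>) ?\<pi>"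
    if min: "is_arg_min objective feasible (\<theta>, V, \<psi>)" for \<theta> V \<psi>
  proof -
    have f: "feasible (\<theta>, V, \<psi>)" and "objective (\<theta>, V, \<psi>) \<le> objective ?z"
      using min feas unfolding is_arg_min_linorder by blast+
    with zero have "?cost \<theta> ?\<pi> \<le> (\<integral>x. V x \<partial>\<mu>\<^sub>1)"
      by (simp add: objective)
    then show ?thesis
      unfolding optimal_policy_def is_arg_min_linorder
      using \<pi>_pol lower[OF f] by (meson order_trans)
  qed
  ultimately show ?thesis
    by blast
qed

end
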